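(* Every $2$-local derivation on the generalized loop Heisenberg-Virasoro algebra $\mathcal{L}(\Gamma)$ is a derivation.
   Context: $\mathbb{F}$ is an algebraically closed field of characteristic zero; all vector spaces and algebras are over $\mathbb{F}$. $\Gamma$ is an additive subgroup of $\mathbb{F}$. The generalized loop Heisenberg-Virasoro algebra $\mathcal{L}(\Gamma)$ is the Lie algebra over $\mathbb{F}$ with basis $\{L_{\alpha,i},H_{\beta,j}\mid \alpha,\beta\in\Gamma,\ i,j\in\mathbb{Z}\}$ and brackets $[L_{\alpha,i},L_{\beta,j}]=(\alpha-\beta)L_{\alpha+\beta,i+j}$, $[L_{\alpha,i},H_{\beta,j}]=-\beta H_{\alpha+\beta,i+j}$, $[H_{\alpha,i},H_{\beta,j}]=0$. A derivation of a Lie algebra $\mathcal{L}$ is a linear map $\mathcal{D}$ with $\mathcal{D}([x,y])=[\mathcal{D}(x),y]+[x,\mathcal{D}(y)]$. A map $\Delta:\mathcal{L}\to\mathcal{L}$ (not assumed linear) is a $2$-local derivation if for every $x,y\in\mathcal{L}$ there exists a derivation $\Delta_{x,y}:\mathcal{L}\to\mathcal{L}$ such that $\Delta(x)=\Delta_{x,y}(x)$ and $\Delta(y)=\Delta_{x,y}(y)$.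
   Formalization: The formal theorem assumes Γ ≠ {0}; for Γ = {0} the algebra is abelian and infinite-dimensional, and the map fixing F·L_{0,0} pointwise and sending every other vector to 0 is a 2-local derivation that is not additive, so the claim fails there. *)

theory Defs
  imports "HOL-Computational_Algebra.Polynomial" "HOL-Library.Poly_Mapping"
    "HOL-Library.FuncSet"
begin

text \<open>
  The underlying space is a subspace of an ambient vector space, so that the Lie algebra
  may depend on a set parameter. Maps on it are total functions whose
  values outside the subspace are irrelevant.
\<close>

locale lie_algebra_on = vector_space scale
  for scale :: "'k::field \<Rightarrow> 'v::ab_group_add \<Rightarrow> 'v" (infixr \<open>*s\<close> 75) +
  fixes V :: "'v set" and br :: "'v \<Rightarrow> 'v \<Rightarrow> 'v"
  assumes subspace_V: "subspace V"
    and br_closed: "x \<in> V \<Longrightarrow> y \<in> V \<Longrightarrow> br x y \<in> V"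
    and br_add_left: "x \<in> V \<Longrightarrow> y \<in> V \<Longrightarrow> z \<in> V \<Longrightarrow> br (x + y) z = br x z + br y z"
    and br_add_right: "x \<in> V \<Longrightarrow> y \<in> V \<Longrightarrow> z \<in> V \<Longrightarrow> br x (y + z) = br x y + br x z"
    and br_scale_left: "x \<in> V \<Longrightarrow> y \<in> V \<Longrightarrow> br (c *s x) y = c *s br x y"
    and br_scale_right: "x \<in> V \<Longrightarrow> y \<in> V \<Longrightarrow> br x (c *s y) = c *s br x y"
    and br_self: "x \<in> V \<Longrightarrow> br x x = 0"
    and jacobi: "x \<in> V \<Longrightarrow> y \<in> V \<Longrightarrow> z \<in> V \<Longrightarrow>
      br x (br y z) + br y (br z x) + br z (br x y) = 0"

definition derivation_on ::
  "('k::field \<Rightarrow> 'v::ab_group_add \<Rightarrow> 'v) \<Rightarrow> 'v set \<Rightarrow> ('v \<Rightarrow> 'v \<Rightarrow> 'v) \<Rightarrow> ('v \<Rightarrow> 'v) \<Rightarrow> bool"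
  where "derivation_on scale V br D \<longleftrightarrow>
    D \<in> V \<rightarrow> V \<and>
    (\<forall>x\<in>V. \<forall>y\<in>V. D (x + y) = D x + D y) \<and>
    (\<forall>c. \<forall>x\<in>V. D (scale c x) = scale c (D x)) \<and>
    (\<forall>x\<in>V. \<forall>y\<in>V. D (br x y) = br (D x) y + br x (D y))"

definition two_local_derivation_on ::
  "('k::field \<Rightarrow> 'v::ab_group_add \<Rightarrow> 'v) \<Rightarrow> 'v set \<Rightarrow> ('v \<Rightarrow> 'v \<Rightarrow> 'v) \<Rightarrow> ('v \<Rightarrow> 'v) \<Rightarrow> bool"
  where "two_local_derivation_on scale V br \<Delta> \<longleftrightarrow>
    \<Delta> \<in> V \<rightarrow> V \<and>
    (\<forall>x\<in>V. \<forall>y\<in>V. \<exists>D. derivation_on scale V br D \<and> \<Delta> x = D x \<and> \<Delta> y = D y)"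


definition additive_subgroup :: "'a::ab_group_add set \<Rightarrow> bool"
  where "additive_subgroup \<Gamma> \<longleftrightarrow>
    0 \<in> \<Gamma> \<and> (\<forall>\<alpha>\<in>\<Gamma>. \<forall>\<beta>\<in>\<Gamma>. \<alpha> + \<beta> \<in> \<Gamma>) \<and> (\<forall>\<alpha>\<in>\<Gamma>. - \<alpha> \<in> \<Gamma>)"

datatype 'a hv_index = L (hv_deg: 'a) int | H (hv_deg: 'a) int

text \<open>
  Finitely supported functions are the formal linear combinations of the symbols
  \<open>L \<alpha> i\<close>, \<open>H \<alpha> i\<close> with \<open>\<alpha>\<close> in the whole field; \<open>hv_space \<Gamma>\<close> keeps those
  with \<open>\<alpha> \<in> \<Gamma>\<close>.
\<close>

type_synonym 'a hv = "'a hv_index \<Rightarrow>\<^sub>0 'a"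

definition hv_scale :: "'a::field \<Rightarrow> 'a hv \<Rightarrow> 'a hv"
  where "hv_scale c x = Poly_Mapping.map ((*) c) x"

definition hv_space :: "'a::field set \<Rightarrow> 'a hv set"
  where "hv_space \<Gamma> = {x. \<forall>a\<in>Poly_Mapping.keys x. hv_deg a \<in> \<Gamma>}"

fun hv_basis_bracket :: "'a::field hv_index \<Rightarrow> 'a hv_index \<Rightarrow> 'a hv"
  where
    "hv_basis_bracket (L \<alpha> i) (L \<beta> j) = Poly_Mapping.single (L (\<alpha> + \<beta>) (i + j)) (\<alpha> - \<beta>)"
  | "hv_basis_bracket (L \<alpha> i) (H \<beta> j) = Poly_Mapping.single (H (\<alpha> + \<beta>) (i + j)) (- \<beta>)"
  | "hv_basis_bracket (H \<alpha> i) (L \<beta> j) = Poly_Mapping.single (H (\<alpha> + \<beta>) (i + j)) \<alpha>"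
  | "hv_basis_bracket (H \<alpha> i) (H \<beta> j) = 0"

definition hv_bracket :: "'a::field hv \<Rightarrow> 'a hv \<Rightarrow> 'a hv"
  where "hv_bracket x y =
    (\<Sum>a\<in>Poly_Mapping.keys x. \<Sum>b\<in>Poly_Mapping.keys y.
      hv_scale (Poly_Mapping.lookup x a * Poly_Mapping.lookup y b) (hv_basis_bracket a b))"


lemma lookup_hv_scale [simp]:
  "Poly_Mapping.lookup (hv_scale c x) a = c * Poly_Mapping.lookup x a"
  unfolding hv_scale_def by transfer (simp add: when_def)

lemma hv_scale_single [simp]:
  "hv_scale c (Poly_Mapping.single a d) = Poly_Mapping.single a (c * d)"
  by (rule poly_mapping_eqI) (simp add: lookup_single when_def)

interpretation hv: vector_space "hv_scale :: 'a::field \<Rightarrow> 'a hv \<Rightarrow> 'a hv"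
  by unfold_locales
    (auto intro!: poly_mapping_eqI simp: lookup_add algebra_simps)

lemma keys_hv_scale: "Poly_Mapping.keys (hv_scale c x) \<subseteq> Poly_Mapping.keys x"
  by (auto simp: in_keys_iff)

lemma subspace_hv_space: "hv.subspace (hv_space \<Gamma>)"
proof (rule hv.subspaceI)
  show "0 \<in> hv_space \<Gamma>" by (simp add: hv_space_def)
next
  fix x y assume "x \<in> hv_space \<Gamma>" "y \<in> hv_space \<Gamma>"
  then show "x + y \<in> hv_space \<Gamma>"
    using Poly_Mapping.keys_add[of x y] by (auto simp: hv_space_def)
next
  fix c x assume "x \<in> hv_space \<Gamma>"
  then show "hv_scale c x \<in> hv_space \<Gamma>"
    using keys_hv_scale[of c x] by (auto simp: hv_space_def)
qed

lemma hv_bracket_superset: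
  assumes "finite A" "Poly_Mapping.keys x \<subseteq> A" "finite B" "Poly_Mapping.keys y \<subseteq> B"
  shows "hv_bracket x y = (\<Sum>a\<in>A. \<Sum>b\<in>B.
    hv_scale (Poly_Mapping.lookup x a * Poly_Mapping.lookup y b) (hv_basis_bracket a b))"
proof -
  have "hv_bracket x y = (\<Sum>a\<in>Poly_Mapping.keys x. \<Sum>b\<in>B.
      hv_scale (Poly_Mapping.lookup x a * Poly_Mapping.lookup y b) (hv_basis_bracket a b))"
    unfolding hv_bracket_def using assms
    by (intro sum.cong refl sum.mono_neutral_left) (auto simp: in_keys_iff)
  also have "\<dots> = (\<Sum>a\<in>A. \<Sum>b\<in>B.
      hv_scale (Poly_Mapping.lookup x a * Poly_Mapping.lookup y b) (hv_basis_bracket a b))"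
    using assms by (intro sum.mono_neutral_left) (auto simp: in_keys_iff)
  finally show ?thesis .
qed

lemma hv_bracket_basis [simp]:
  "hv_bracket (Poly_Mapping.single a c) (Poly_Mapping.single b d)
    = hv_scale (c * d) (hv_basis_bracket a b)"
  by (subst hv_bracket_superset[of "{a}" _ "{b}"]) auto

lemma hv_bracket_add_left: "hv_bracket (x + y) z = hv_bracket x z + hv_bracket y z"
proof -
  let ?A = "Poly_Mapping.keys x \<union> Poly_Mapping.keys y" and ?B = "Poly_Mapping.keys z"
  show ?thesis
    using Poly_Mapping.keys_add[of x y]
    by (simp add: hv_bracket_superset[of ?A _ ?B] lookup_add algebra_simps
        hv.scale_left_distrib sum.distrib)
qed

lemma hv_bracket_add_right: "hv_bracket x (y + z) = hv_bracket x y + hv_bracket x z"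
proof -
  let ?A = "Poly_Mapping.keys x" and ?B = "Poly_Mapping.keys y \<union> Poly_Mapping.keys z"
  show ?thesis
    using Poly_Mapping.keys_add[of y z]
    by (simp add: hv_bracket_superset[of ?A _ ?B] lookup_add algebra_simps
        hv.scale_left_distrib sum.distrib)
qed

lemma hv_bracket_scale_left: "hv_bracket (hv_scale c x) y = hv_scale c (hv_bracket x y)"
  using keys_hv_scale[of c x]
  by (simp add: hv_bracket_superset[of "Poly_Mapping.keys x" _ "Poly_Mapping.keys y"]
      hv.scale_sum_right mult.assoc)

lemma hv_bracket_scale_right: "hv_bracket x (hv_scale c y) = hv_scale c (hv_bracket x y)"
  using keys_hv_scale[of c y]
  by (simp add: hv_bracket_superset[of "Poly_Mapping.keys x" _ "Poly_Mapping.keys y"]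
      hv.scale_sum_right ac_simps)

lemma hv_basis_bracket_space:
  assumes "additive_subgroup \<Gamma>" "hv_deg a \<in> \<Gamma>" "hv_deg b \<in> \<Gamma>"
  shows "hv_basis_bracket a b \<in> hv_space \<Gamma>"
  using assms
  by (cases a; cases b) (auto simp: hv_space_def additive_subgroup_def split: if_splits)

lemma hv_bracket_closed:
  assumes "additive_subgroup \<Gamma>" "x \<in> hv_space \<Gamma>" "y \<in> hv_space \<Gamma>"
  shows "hv_bracket x y \<in> hv_space \<Gamma>"
  unfolding hv_bracket_def using assms
  by (intro hv.subspace_sum[OF subspace_hv_space] hv.subspace_scale[OF subspace_hv_space]
      hv_basis_bracket_space) (auto simp: hv_space_def)

lemma hv_induct [case_names single add]:
  assumes "\<And>a c. P (Poly_Mapping.single a c)" and "\<And>x y. P x \<Longrightarrow> P y \<Longrightarrow> P (x + y)"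
  shows "P (x :: 'a::field hv)"
proof (induction x rule: Poly_Mapping.update_induct)
  case const
  show ?case using assms(1)[of undefined 0] by simp
next
  case (update f a b)
  have "Poly_Mapping.update a b f = f + Poly_Mapping.single a b"
    using update.hyps
    by (intro poly_mapping_eqI)
      (auto simp: lookup_update lookup_add lookup_single when_def in_keys_iff)
  then show ?case using assms update.IH by simp
qed

lemma hv_bracket_anticomm: "hv_bracket x y = - hv_bracket y x"
proof (induction x rule: hv_induct)
  case (single a c)
  show ?case
  proof (induction y rule: hv_induct)
    case (single b d)
    show ?case
      by (cases a; cases b)
        (auto intro!: poly_mapping_eqI simp: lookup_single when_def algebra_simps)
  qed (simp add: hv_bracket_add_left hv_bracket_add_right)
qed (simp add: hv_bracket_add_left hv_bracket_add_right)

lemma hv_bracket_self: "hv_bracket x x = 0"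
proof (induction x rule: hv_induct)
  case (single a c)
  show ?case by (cases a) auto
next
  case (add x y)
  then show ?case
    using hv_bracket_anticomm[of x y] by (simp add: hv_bracket_add_left hv_bracket_add_right)
qed

lemma hv_bracket_zero [simp]: "hv_bracket 0 x = 0" "hv_bracket x 0 = 0"
  by (simp_all add: hv_bracket_def)

lemma sum3_zero:
  fixes a b c d e f :: "'a::ab_group_add"
  assumes "a + c + e = 0" "b + d + f = 0"
  shows "(a + b) + (c + d) + (e + f) = 0"
proof -
  have "(a + b) + (c + d) + (e + f) = (a + c + e) + (b + d + f)"
    by (simp add: ac_simps)
  with assms show ?thesis by simp
qed

lemma single_eq_zeroI: "c = 0 \<Longrightarrow> Poly_Mapping.single a c = 0"
  by simp

lemma hv_bracket_jacobi:
  "hv_bracket x (hv_bracket y z) + hv_bracket y (hv_bracket z x)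
    + hv_bracket z (hv_bracket x y) = 0"
proof (induction x rule: hv_induct)
  case x: (single a c)
  show ?case
  proof (induction y rule: hv_induct)
    case y: (single b d)
    show ?case
    proof (induction z rule: hv_induct)
      case (single e f)
      show ?case
        by (cases a; cases b; cases e)
          (simp_all add: ac_simps flip: single_add,
            (rule single_eq_zeroI, simp add: algebra_simps)+)
    next
      case (add x y)
      then show ?case
        by (simp only: hv_bracket_add_left hv_bracket_add_right sum3_zero)
    qed
  next
    case (add x y)
    then show ?case
      by (simp only: hv_bracket_add_left hv_bracket_add_right sum3_zero)
  qed
next
  case (add x y)
  then show ?case
    by (simp only: hv_bracket_add_left hv_bracket_add_right sum3_zero)
qed

theorem hv_lie_algebra:
  assumes "additive_subgroup \<Gamma>"
  shows "lie_algebra_on hv_scale (hv_space \<Gamma>) hv_bracket"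
  by unfold_locales
    (use assms in \<open>auto simp: subspace_hv_space hv_bracket_closed hv_bracket_add_left
      hv_bracket_add_right hv_bracket_scale_left hv_bracket_scale_right hv_bracket_self
      hv_bracket_jacobi\<close>)

end

theory Submission
  imports Defs
begin

text \<open>
  Write \<open>A = F[t, t\<^sup>-\<^sup>1]\<close>, so that the algebra is the \<open>\<Gamma>\<close>-graded free \<open>A\<close>-module on symbols
  \<open>L\<^sub>\<alpha>\<close>, \<open>H\<^sub>\<alpha>\<close>, where \<open>L \<alpha> i\<close> is \<open>t\<^sup>i L\<^sub>\<alpha>\<close>. The proof shows that for every finite set \<open>S\<close> of degrees
  a \<open>2\<close>-local derivation \<open>\<Delta>\<close> coincides, on all elements supported in \<open>S\<close>, with one single
  derivation (\<open>two_local_is_derivation_on_finite_support\<close>). This is enough, because each of the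
  identities that make \<open>\<Delta>\<close> a derivation involves only finitely many elements.

  Since bracketing with \<open>L\<^sub>0\<close> multiplies by the degree, each derivation is an inner one plus one that
  preserves degrees (\<open>derivation_inner_plus_degree_preserving\<close>). A degree-preserving derivation that
  kills \<open>t L\<^sub>0\<close> is \<open>A\<close>-linear, of the form \<open>L\<^sub>\<gamma> \<mapsto> c(\<gamma>) L\<^sub>\<gamma> + d(\<gamma>) H\<^sub>\<gamma>\<close>,
  \<open>H\<^sub>\<gamma> \<mapsto> (c(\<gamma>) + h) H\<^sub>\<gamma>\<close> with \<open>c\<close> and \<open>d\<close> compatible with natural multiples of a degree
  (\<open>degree_preserving_form\<close>).

  The central device is the probe \<open>y = t L\<^sub>0 + L\<^sub>\<omega> + H\<^sub>\<alpha>\<close> with \<open>\<omega> = n \<alpha>\<close>, \<open>\<alpha> \<noteq> 0\<close>, \<open>n \<ge> 2\<close>. If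
  \<open>D y\<close> creates no new degrees, then the coefficients of the inner part of \<open>D\<close> satisfy a recursion
  in steps of \<open>\<omega>\<close>; being finitely supported, they can only be those of \<open>p (L\<^sub>\<omega> + H\<^sub>\<alpha>)\<close> for some
  \<open>p \<in> A\<close> (\<open>normalizer_of_probe\<close>). Thus a derivation that kills \<open>y\<close> is \<open>p \<cdot> ad y\<close> plus an \<open>A\<close>-linear
  derivation that vanishes in the degrees \<open>0\<close> and \<open>\<alpha>\<close>.

  Now subtract from \<open>\<Delta>\<close> a derivation that agrees with it at \<open>t L\<^sub>0\<close> and at a master element \<open>z\<close>, the
  superposition of the probes for all nonzero \<open>\<alpha> \<in> S\<close> and one extra term \<open>L\<^sub>\<eta>\<close> of generic degree.
  Pairing \<open>x\<close> with \<open>t L\<^sub>0\<close> shows that \<open>\<Delta> x\<close> has no degrees that \<open>x\<close> does not have. Pairing a probe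
  with \<open>z\<close> shows that \<open>\<Delta>\<close> kills the probe: a nonzero \<open>p\<close> would leave a trace of \<open>L\<^sub>\<eta>\<close> in degree
  \<open>\<eta> + \<omega>\<close>. Pairing \<open>x\<close>, supported in \<open>S\<close>, with the probe for \<open>\<alpha>\<close> shows that \<open>\<Delta> x\<close> vanishes in the
  degrees \<open>0\<close> and \<open>\<alpha>\<close>: for suitable \<open>n\<close> the bracket of \<open>p y\<close> with \<open>x\<close> has a component outside \<open>S\<close>,
  where \<open>\<Delta> x\<close> has none, unless \<open>p = 0\<close> or \<open>x\<close> is central. Letting \<open>\<alpha>\<close> run through \<open>S\<close> gives
  \<open>\<Delta> x = 0\<close>.
\<close>

section \<open>Laurent polynomial coefficients\<close>

abbreviation mon :: "int \<Rightarrow> 'a::field \<Rightarrow> (int \<Rightarrow>\<^sub>0 'a)"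
  where "mon i c \<equiv> Poly_Mapping.single i c"

abbreviation hv_basis :: "'a hv_index \<Rightarrow> 'a::field hv"
  where "hv_basis a \<equiv> Poly_Mapping.single a 1"

text \<open>
  The \<open>L\<close>- and \<open>H\<close>-coefficients of an element in degree \<open>\<alpha>\<close>, as Laurent polynomials in \<open>t\<close>. The type
  \<open>int \<Rightarrow>\<^sub>0 'a\<close> of Laurent polynomials is an integral domain, which allows cancellation in the
  equations below.
\<close>

definition lc :: "'a::field hv \<Rightarrow> 'a \<Rightarrow> (int \<Rightarrow>\<^sub>0 'a)"
  where "lc x \<alpha> = Poly_Mapping.map_key (L \<alpha>) x"

definition hc :: "'a::field hv \<Rightarrow> 'a \<Rightarrow> (int \<Rightarrow>\<^sub>0 'a)"
  where "hc x \<alpha> = Poly_Mapping.map_key (H \<alpha>) x"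

lemma lookup_lc [simp]: "Poly_Mapping.lookup (lc x \<alpha>) i = Poly_Mapping.lookup x (L \<alpha> i)"
  by (simp add: lc_def map_key.rep_eq inj_def)

lemma lookup_hc [simp]: "Poly_Mapping.lookup (hc x \<alpha>) i = Poly_Mapping.lookup x (H \<alpha> i)"
  by (simp add: hc_def map_key.rep_eq inj_def)

lemma hv_eqI:
  assumes "\<And>\<gamma>. lc x \<gamma> = lc y \<gamma>" "\<And>\<gamma>. hc x \<gamma> = hc y \<gamma>"
  shows "x = y"
proof (rule poly_mapping_eqI)
  fix a show "Poly_Mapping.lookup x a = Poly_Mapping.lookup y a"
    by (cases a) (metis assms lookup_lc lookup_hc)+
qed

lemma mon_eq_0_iff [simp]: "mon i c = 0 \<longleftrightarrow> c = 0"
  by (auto dest: arg_cong[where f = "\<lambda>p. Poly_Mapping.lookup p i"])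

lemma lookup_mon_times:
  "Poly_Mapping.lookup (mon 0 c * p) i = c * Poly_Mapping.lookup p i"
  by (simp add: Poly_Mapping.map.rep_eq when_def flip: mult_map_scale_conv_mult)

lemma coeff_simps [simp]:
  "lc 0 \<gamma> = 0" "hc 0 \<gamma> = 0"
  "lc (x + y) \<gamma> = lc x \<gamma> + lc y \<gamma>" "hc (x + y) \<gamma> = hc x \<gamma> + hc y \<gamma>"
  "lc (x - y) \<gamma> = lc x \<gamma> - lc y \<gamma>" "hc (x - y) \<gamma> = hc x \<gamma> - hc y \<gamma>"
  "lc (- x) \<gamma> = - lc x \<gamma>" "hc (- x) \<gamma> = - hc x \<gamma>"
  "lc (hv_scale c x) \<gamma> = mon 0 c * lc x \<gamma>" "hc (hv_scale c x) \<gamma> = mon 0 c * hc x \<gamma>"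
  "lc (Poly_Mapping.single (L \<alpha> i) c) \<gamma> = (if \<gamma> = \<alpha> then mon i c else 0)"
  "hc (Poly_Mapping.single (L \<alpha> i) c) \<gamma> = 0"
  "lc (Poly_Mapping.single (H \<alpha> i) c) \<gamma> = 0"
  "hc (Poly_Mapping.single (H \<alpha> i) c) \<gamma> = (if \<gamma> = \<alpha> then mon i c else 0)"
  by (auto intro!: poly_mapping_eqI simp: lookup_add lookup_minus lookup_single
      lookup_mon_times when_def)

lemma coeff_sum:
  "lc (sum f A) \<gamma> = (\<Sum>a\<in>A. lc (f a) \<gamma>)" "hc (sum f A) \<gamma> = (\<Sum>a\<in>A. hc (f a) \<gamma>)"
  by (induction A rule: infinite_finite_induct) auto

lemma coeff_bracket_right [simp]:
  "lc (hv_bracket x (Poly_Mapping.single (L \<beta> j) b)) \<gamma> = mon j (b * (\<gamma> - 2 * \<beta>)) * lc x (\<gamma> - \<beta>)"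
  "hc (hv_bracket x (Poly_Mapping.single (L \<beta> j) b)) \<gamma> = mon j (b * (\<gamma> - \<beta>)) * hc x (\<gamma> - \<beta>)"
  "lc (hv_bracket x (Poly_Mapping.single (H \<beta> j) b)) \<gamma> = 0"
  "hc (hv_bracket x (Poly_Mapping.single (H \<beta> j) b)) \<gamma> = mon j (- b * \<beta>) * lc x (\<gamma> - \<beta>)"
proof (induction x rule: hv_induct)
  case (single a c)
  { case 1 show ?case by (cases a) (auto simp: mult_single algebra_simps) }
  { case 2 show ?case by (cases a) (auto simp: mult_single algebra_simps) }
  { case 3 show ?case by (cases a) (auto simp: mult_single algebra_simps) }
  { case 4 show ?case by (cases a) (auto simp: mult_single algebra_simps) }
qed (simp_all add: hv_bracket_add_left distrib_left)

lemma hv_bracket_minus_left: "hv_bracket (x - y) z = hv_bracket x z - hv_bracket y z"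
  using hv_bracket_add_left[of "x - y" y z] by (simp add: algebra_simps)

lemma hv_bracket_minus_right: "hv_bracket z (x - y) = hv_bracket z x - hv_bracket z y"
  using hv_bracket_add_right[of z "x - y" y] by (simp add: algebra_simps)

lemma mon_split: "mon i c = mon 0 c * mon i 1" by (simp add: mult_single)

lemma lookup_bracket_L0:
  "Poly_Mapping.lookup (hv_bracket x (hv_basis (L 0 0))) a = hv_deg a * Poly_Mapping.lookup x a"
proof (cases a)
  case (L \<gamma> i)
  then show ?thesis
    using arg_cong[OF coeff_bracket_right(1)[of x 0 0 1 \<gamma>], of "\<lambda>p. Poly_Mapping.lookup p i"]
    by (simp del: coeff_bracket_right add: lookup_mon_times)
next
  case (H \<gamma> i)
  then show ?thesis
    using arg_cong[OF coeff_bracket_right(2)[of x 0 0 1 \<gamma>], of "\<lambda>p. Poly_Mapping.lookup p i"]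
    by (simp del: coeff_bracket_right add: lookup_mon_times)
qed

lemma coeff_bracket_left:
  "lc (hv_bracket (Poly_Mapping.single (L \<beta> j) b) x) \<gamma> = mon j (b * (2 * \<beta> - \<gamma>)) * lc x (\<gamma> - \<beta>)"
  "hc (hv_bracket (Poly_Mapping.single (L \<beta> j) b) x) \<gamma> = mon j (b * (\<beta> - \<gamma>)) * hc x (\<gamma> - \<beta>)"
  "lc (hv_bracket (Poly_Mapping.single (H \<beta> j) b) x) \<gamma> = 0"
  "hc (hv_bracket (Poly_Mapping.single (H \<beta> j) b) x) \<gamma> = mon j (b * \<beta>) * lc x (\<gamma> - \<beta>)"
proof -
  have neg: "mon j (b * (c - d)) = - mon j (b * (d - c))" for c d
    by (simp add: right_diff_distrib flip: single_uminus)
  show "lc (hv_bracket (Poly_Mapping.single (L \<beta> j) b) x) \<gamma> = mon j (b * (2 * \<beta> - \<gamma>)) * lc x (\<gamma> - \<beta>)"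
    "hc (hv_bracket (Poly_Mapping.single (L \<beta> j) b) x) \<gamma> = mon j (b * (\<beta> - \<gamma>)) * hc x (\<gamma> - \<beta>)"
    "lc (hv_bracket (Poly_Mapping.single (H \<beta> j) b) x) \<gamma> = 0"
    "hc (hv_bracket (Poly_Mapping.single (H \<beta> j) b) x) \<gamma> = mon j (b * \<beta>) * lc x (\<gamma> - \<beta>)"
    by (subst hv_bracket_anticomm, simp add: neg[of "2 * \<beta>"] neg[of \<beta>] single_uminus)+
qed

text \<open>
  In the recursions for an inner derivation, the inner part turns out to be of the form
  \<open>u = p L\<^sub>\<omega> + q H\<^sub>\<alpha>\<close>.
\<close>

lemma coeff_bracket_two_term:
  assumes "\<And>\<gamma>. lc u \<gamma> = (if \<gamma> = \<omega> then p else 0)" "\<And>\<gamma>. hc u \<gamma> = (if \<gamma> = \<alpha> then q else 0)"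
  shows "lc (hv_bracket u x) \<gamma> = mon 0 (2 * \<omega> - \<gamma>) * lc x (\<gamma> - \<omega>) * p"
    and "hc (hv_bracket u x) \<gamma> =
      mon 0 (\<omega> - \<gamma>) * hc x (\<gamma> - \<omega>) * p + mon 0 \<alpha> * lc x (\<gamma> - \<alpha>) * q"
proof (induction x rule: hv_induct)
  case (single a c)
  { case 1 show ?case by (cases a) (auto simp: mult_single assms algebra_simps) }
  { case 2 show ?case by (cases a) (auto simp: mult_single assms algebra_simps) }
qed (simp_all add: hv_bracket_add_right algebra_simps)

text \<open>
  In characteristic zero a shift has infinite orbits. This turns the recursions for coefficients of
  finitely supported elements into vanishing statements.
\<close>

lemma finite_shift_closed_empty:
  fixes X :: "'a::field_char_0 set"
  assumes "finite X" "\<omega> \<noteq> 0" "\<And>\<gamma>. \<gamma> \<in> X \<Longrightarrow> \<gamma> + \<omega> \<in> X"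
  shows "X = {}"
proof (rule ccontr)
  assume "X \<noteq> {}"
  then obtain \<gamma> where \<gamma>: "\<gamma> \<in> X" by blast
  have "\<gamma> + of_nat k * \<omega> \<in> X" for k
  proof (induction k)
    case (Suc k)
    from assms(3)[OF Suc] show ?case by (simp add: algebra_simps)
  qed (simp add: \<gamma>)
  then have "range (\<lambda>k. \<gamma> + of_nat k * \<omega>) \<subseteq> X" by blast
  moreover have "inj (\<lambda>k. \<gamma> + of_nat k * \<omega>)" using assms(2) by (auto simp: inj_def)
  ultimately show False using assms(1) by (metis finite_subset range_inj_infinite)
qed

lemma finite_avoiding_multiple:
  fixes A S :: "'a::field_char_0 set"
  assumes "finite A" "finite S" "0 \<notin> A"
  obtains n :: nat where "n \<ge> 2"
    "\<And>\<alpha> \<beta>. \<alpha> \<in> A \<Longrightarrow> \<beta> \<in> S \<Longrightarrow> of_nat n * \<alpha> + \<beta> \<notin> S"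
proof -
  define B where "B = (\<Union>\<alpha>\<in>A. \<Union>\<beta>\<in>S. \<Union>\<sigma>\<in>S. {n :: nat. of_nat n * \<alpha> + \<beta> = \<sigma>})"
  have fin: "finite {n :: nat. of_nat n * \<alpha> + \<beta> = \<sigma>}" if "\<alpha> \<in> A" for \<alpha> \<beta> \<sigma>
  proof (rule finite_subset)
    have "\<alpha> \<noteq> 0" using that assms(3) by blast
    then show "{n :: nat. of_nat n * \<alpha> + \<beta> = \<sigma>} \<subseteq> {inv of_nat ((\<sigma> - \<beta>) / \<alpha>)}"
      by (auto simp: inv_f_f[OF inj_of_nat])
  qed simp
  have "finite (B \<union> {0, 1})" unfolding B_def using assms(1,2) fin by simp
  then obtain n where "n \<notin> B \<union> {0, 1}" using ex_new_if_finite[OF infinite_UNIV_nat] by blast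
  then show ?thesis using that[of n] unfolding B_def by force
qed

lemma finite_coeff_support: "finite {\<gamma>. lc x \<gamma> \<noteq> 0}" "finite {\<gamma>. hc x \<gamma> \<noteq> 0}"
proof -
  have "{\<gamma>. lc x \<gamma> \<noteq> 0} \<subseteq> hv_deg ` Poly_Mapping.keys x"
    "{\<gamma>. hc x \<gamma> \<noteq> 0} \<subseteq> hv_deg ` Poly_Mapping.keys x"
    by (force simp: poly_mapping_eq_iff fun_eq_iff in_keys_iff)+
  then show "finite {\<gamma>. lc x \<gamma> \<noteq> 0}" "finite {\<gamma>. hc x \<gamma> \<noteq> 0}"
    by (auto intro: finite_subset)
qed

text \<open>
  Intended for \<open>\<omega> = n \<alpha>\<close> with \<open>n \<ge> 2\<close>. The term \<open>t L\<^sub>0\<close> excludes the derivation \<open>d/dt\<close>. Since \<open>\<omega>\<close>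
  is a multiple of \<open>\<alpha>\<close>, the values at \<open>L\<^sub>\<omega>\<close> and \<open>H\<^sub>\<alpha>\<close> determine in degree \<open>\<alpha>\<close> any degree-preserving
  derivation that kills \<open>t L\<^sub>0\<close>; as \<open>\<omega> \<noteq> \<alpha>\<close>, these two values do not mix.
\<close>

definition probe :: "'a::field \<Rightarrow> 'a \<Rightarrow> 'a hv"
  where "probe \<omega> \<alpha> = hv_basis (L 0 1) + hv_basis (L \<omega> 0) + hv_basis (H \<alpha> 0)"

lemma lc_probe: "lc (probe \<omega> \<alpha>) \<gamma> = (if \<gamma> = 0 then mon 1 1 else 0) + (if \<gamma> = \<omega> then 1 else 0)"
  and hc_probe: "hc (probe \<omega> \<alpha>) \<gamma> = (if \<gamma> = \<alpha> then 1 else 0)"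
  by (simp_all add: probe_def)

section \<open>Derivations and their degree-preserving part\<close>

locale hv_grading =
  fixes \<Gamma> :: "'a::field_char_0 set"
  assumes subgroup: "additive_subgroup \<Gamma>" and nontrivial: "\<Gamma> \<noteq> {0}"
begin

abbreviation V where "V \<equiv> hv_space \<Gamma>"

abbreviation derivation :: "('a hv \<Rightarrow> 'a hv) \<Rightarrow> bool"
  where "derivation \<equiv> derivation_on hv_scale V hv_bracket"

lemma subgroup_closed:
  "0 \<in> \<Gamma>" "\<alpha> \<in> \<Gamma> \<Longrightarrow> \<beta> \<in> \<Gamma> \<Longrightarrow> \<alpha> + \<beta> \<in> \<Gamma>" "\<alpha> \<in> \<Gamma> \<Longrightarrow> - \<alpha> \<in> \<Gamma>"
  "\<alpha> \<in> \<Gamma> \<Longrightarrow> \<beta> \<in> \<Gamma> \<Longrightarrow> \<alpha> - \<beta> \<in> \<Gamma>"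
proof -
  show add: "\<alpha> \<in> \<Gamma> \<Longrightarrow> \<beta> \<in> \<Gamma> \<Longrightarrow> \<alpha> + \<beta> \<in> \<Gamma>" and neg: "\<alpha> \<in> \<Gamma> \<Longrightarrow> - \<alpha> \<in> \<Gamma>" and "0 \<in> \<Gamma>"
    for \<alpha> \<beta> using subgroup unfolding additive_subgroup_def by auto
  show "\<alpha> \<in> \<Gamma> \<Longrightarrow> \<beta> \<in> \<Gamma> \<Longrightarrow> \<alpha> - \<beta> \<in> \<Gamma>" using add[of \<alpha> "- \<beta>"] neg[of \<beta>] by simp
qed

lemma subgroup_multiple: "\<alpha> \<in> \<Gamma> \<Longrightarrow> of_nat n * \<alpha> \<in> \<Gamma>"
  by (induction n) (auto simp: subgroup_closed algebra_simps)

lemma obtain_nonzero: obtains \<alpha> where "\<alpha> \<in> \<Gamma>" "\<alpha> \<noteq> 0"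
  using nontrivial subgroup_closed(1) by blast

lemma hv_space_closed:
  "hv_deg a \<in> \<Gamma> \<Longrightarrow> Poly_Mapping.single a c \<in> V"
  "x \<in> V \<Longrightarrow> y \<in> V \<Longrightarrow> x + y \<in> V"
  "x \<in> V \<Longrightarrow> y \<in> V \<Longrightarrow> x - y \<in> V"
  "x \<in> V \<Longrightarrow> hv_scale c x \<in> V"
  "x \<in> V \<Longrightarrow> y \<in> V \<Longrightarrow> hv_bracket x y \<in> V"
  "(\<And>i. i \<in> I \<Longrightarrow> f i \<in> V) \<Longrightarrow> sum f I \<in> V"
proof -
  show "hv_deg a \<in> \<Gamma> \<Longrightarrow> Poly_Mapping.single a c \<in> V"
    by (auto simp: hv_space_def split: if_splits)
  show "x \<in> V \<Longrightarrow> y \<in> V \<Longrightarrow> x + y \<in> V" "x \<in> V \<Longrightarrow> y \<in> V \<Longrightarrow> x - y \<in> V"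
    "x \<in> V \<Longrightarrow> hv_scale c x \<in> V" "(\<And>i. i \<in> I \<Longrightarrow> f i \<in> V) \<Longrightarrow> sum f I \<in> V"
    by (rule hv.subspace_add hv.subspace_diff hv.subspace_scale hv.subspace_sum,
        rule subspace_hv_space, assumption+)+
  show "x \<in> V \<Longrightarrow> y \<in> V \<Longrightarrow> hv_bracket x y \<in> V"
    by (rule hv_bracket_closed[OF subgroup])
qed

lemma hv_space_coeff_outside:
  assumes "x \<in> V" "\<gamma> \<notin> \<Gamma>" shows "lc x \<gamma> = 0" "hc x \<gamma> = 0"
proof -
  have "Poly_Mapping.lookup x a = 0" if "hv_deg a = \<gamma>" for a
    using assms that by (auto simp: hv_space_def in_keys_iff)
  then show "lc x \<gamma> = 0" "hc x \<gamma> = 0" by (auto intro!: poly_mapping_eqI)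
qed

lemma hv_space_induct [consumes 1, case_names basis scale add]:
  assumes "x \<in> V"
    and basis: "\<And>a. hv_deg a \<in> \<Gamma> \<Longrightarrow> P (hv_basis a)"
    and scale: "\<And>c x. x \<in> V \<Longrightarrow> P x \<Longrightarrow> P (hv_scale c x)"
    and add: "\<And>x y. x \<in> V \<Longrightarrow> y \<in> V \<Longrightarrow> P x \<Longrightarrow> P y \<Longrightarrow> P (x + y)"
  shows "P x"
  using assms(1)
proof (induction x rule: Poly_Mapping.update_induct)
  case const
  have "P (hv_scale 0 (hv_basis (L 0 0)))"
    by (intro scale basis hv_space_closed) (auto simp: subgroup_closed)
  then show ?case by simp
next
  case (update f a b)
  have eq: "Poly_Mapping.update a b f = f + hv_scale b (hv_basis a)"
    using update.hyps
    by (intro poly_mapping_eqI)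
      (auto simp: lookup_update lookup_add lookup_single when_def in_keys_iff)
  have keys: "Poly_Mapping.keys (Poly_Mapping.update a b f) = insert a (Poly_Mapping.keys f)"
    using update.hyps by (auto simp: in_keys_iff lookup_update split: if_splits)
  have "f \<in> V" "hv_deg a \<in> \<Gamma>"
    using update.prems by (auto simp: hv_space_def keys)
  then show ?case
    unfolding eq using update.IH by (intro add scale basis hv_space_closed) auto
qed

lemma derivationD:
  assumes "derivation D"
  shows "x \<in> V \<Longrightarrow> D x \<in> V" "x \<in> V \<Longrightarrow> y \<in> V \<Longrightarrow> D (x + y) = D x + D y"
    "x \<in> V \<Longrightarrow> D (hv_scale c x) = hv_scale c (D x)"
    "x \<in> V \<Longrightarrow> y \<in> V \<Longrightarrow> D (hv_bracket x y) = hv_bracket (D x) y + hv_bracket x (D y)"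
  using assms by (auto simp: derivation_on_def)

lemma derivation_diff:
  assumes "derivation D" "derivation E" shows "derivation (\<lambda>x. D x - E x)"
  unfolding derivation_on_def
  by (auto simp: derivationD[OF assms(1)] derivationD[OF assms(2)] hv_space_closed
      hv.scale_right_diff_distrib hv_bracket_minus_left hv_bracket_minus_right)

lemma derivation_inner:
  assumes "u \<in> V" shows "derivation (hv_bracket u)"
proof -
  have "hv_bracket u (hv_bracket x y) = hv_bracket (hv_bracket u x) y + hv_bracket x (hv_bracket u y)"
    for x y
  proof -
    have "hv_bracket x (hv_bracket y u) = - hv_bracket x (hv_bracket u y)"
      using hv_bracket_minus_right[of x 0 "hv_bracket u y"] hv_bracket_anticomm[of y u] by simp
    moreover have "hv_bracket y (hv_bracket u x) = - hv_bracket (hv_bracket u x) y"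
      by (rule hv_bracket_anticomm)
    ultimately show ?thesis using hv_bracket_jacobi[of u x y] by (simp add: algebra_simps)
  qed
  then show ?thesis
    using assms unfolding derivation_on_def
    by (auto simp: hv_space_closed hv_bracket_add_right hv_bracket_scale_right)
qed

abbreviation two_local :: "('a hv \<Rightarrow> 'a hv) \<Rightarrow> bool"
  where "two_local \<equiv> two_local_derivation_on hv_scale V hv_bracket"

lemma two_localD:
  assumes "two_local \<Delta>"
  shows "x \<in> V \<Longrightarrow> \<Delta> x \<in> V"
    and "x \<in> V \<Longrightarrow> y \<in> V \<Longrightarrow> \<exists>D. derivation D \<and> \<Delta> x = D x \<and> \<Delta> y = D y"
proof -
  have \<Delta>: "\<Delta> \<in> V \<rightarrow> V" "\<forall>x\<in>V. \<forall>y\<in>V. \<exists>D. derivation D \<and> \<Delta> x = D x \<and> \<Delta> y = D y"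
    using assms unfolding two_local_derivation_on_def by (rule conjunct1, rule conjunct2)
  show "x \<in> V \<Longrightarrow> \<Delta> x \<in> V" by (rule funcset_mem[OF \<Delta>(1)])
  show "x \<in> V \<Longrightarrow> y \<in> V \<Longrightarrow> \<exists>D. derivation D \<and> \<Delta> x = D x \<and> \<Delta> y = D y"
    by (rule \<Delta>(2)[rule_format])
qed

lemma two_local_diff:
  assumes "two_local \<Delta>" "derivation E"
  shows "two_local (\<lambda>x. \<Delta> x - E x)"
  unfolding two_local_derivation_on_def
proof (intro conjI ballI Pi_I)
  fix x assume "x \<in> V"
  then show "\<Delta> x - E x \<in> V"
    by (intro hv_space_closed(3) two_localD(1)[OF assms(1)] derivationD(1)[OF assms(2)])
next
  fix x y assume "x \<in> V" "y \<in> V"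
  then obtain D where D: "derivation D" "\<Delta> x = D x" "\<Delta> y = D y"
    using two_localD(2)[OF assms(1)] by metis
  show "\<exists>D. derivation D \<and> \<Delta> x - E x = D x \<and> \<Delta> y - E y = D y"
    by (rule exI[of _ "\<lambda>x. D x - E x"]) (simp only: D(2,3) derivation_diff[OF D(1) assms(2)] simp_thms)
qed

text \<open>
  Stronger than preserving degrees: the abelian ideal spanned by all \<open>H \<alpha> i\<close> has to be invariant too.
\<close>

definition degree_preserving :: "('a hv \<Rightarrow> 'a hv) \<Rightarrow> bool"
  where "degree_preserving D \<longleftrightarrow>
    (\<forall>\<alpha>\<in>\<Gamma>. \<forall>i \<gamma>. \<gamma> \<noteq> \<alpha> \<longrightarrow> lc (D (hv_basis (L \<alpha> i))) \<gamma> = 0 \<and> hc (D (hv_basis (L \<alpha> i))) \<gamma> = 0) \<and>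
    (\<forall>\<alpha>\<in>\<Gamma>. \<forall>i \<gamma>. lc (D (hv_basis (H \<alpha> i))) \<gamma> = 0 \<and> (\<gamma> \<noteq> \<alpha> \<longrightarrow> hc (D (hv_basis (H \<alpha> i))) \<gamma> = 0))"

text \<open>
  Since \<open>[x, L\<^sub>0] = \<gamma> x\<close> for \<open>x\<close> of degree \<open>\<gamma>\<close>, dividing the component of \<open>D L\<^sub>0\<close> in degree \<open>\<gamma> \<noteq> 0\<close> by \<open>\<gamma>\<close>
  gives \<open>u\<close> such that \<open>(D - ad u) L\<^sub>0\<close> has degree \<open>0\<close>; applying \<open>D - ad u\<close> to
  \<open>[b, L\<^sub>0] = \<gamma> b\<close> then forces it to preserve the degree of every basis vector \<open>b\<close>. That no \<open>H\<close> is
  sent to an \<open>L\<close> of the same degree follows from the brackets \<open>[L\<^sub>\<alpha>, H\<^sub>\<beta>]\<close>, since the \<open>L\<^sub>\<beta>\<close> and the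
  \<open>H\<^sub>\<beta>\<close> transform differently.
\<close>

lemma derivation_inner_plus_degree_preserving:
  assumes D: "derivation D"
  obtains u E where "u \<in> V" "lc u 0 = 0" "hc u 0 = 0" "derivation E" "degree_preserving E"
    "\<And>x. D x = hv_bracket u x + E x"
proof -
  define w where "w = D (hv_basis (L 0 0))"
  define u where "u = Poly_Mapping.mapp (\<lambda>a c. c / hv_deg a) w"
  define E where "E = (\<lambda>x. D x - hv_bracket u x)"
  have L0: "hv_basis (L 0 i) \<in> V" for i by (intro hv_space_closed) (simp add: subgroup_closed)
  \<comment> \<open>Division by zero yields zero, so u has no component of degree 0.\<close>
  have lu: "Poly_Mapping.lookup u a = Poly_Mapping.lookup w a / hv_deg a" for a
    by (simp add: u_def lookup_mapp when_def in_keys_iff)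
  have "w \<in> V" unfolding w_def by (intro derivationD(1)[OF D] L0)
  then have u: "u \<in> V"
    using keys_mapp_subset[of "\<lambda>a c. c / hv_deg a" w] by (auto simp: hv_space_def u_def)
  have E: "derivation E"
    unfolding E_def by (intro derivation_diff D derivation_inner u)
  define e where "e = E (hv_basis (L 0 0))"
  have e0: "Poly_Mapping.lookup e a = 0" if "hv_deg a \<noteq> 0" for a
    using that by (simp add: e_def E_def lookup_minus lookup_bracket_L0 lu flip: w_def)
  have lce: "lc e \<gamma> = 0" "hc e \<gamma> = 0" if "\<gamma> \<noteq> 0" for \<gamma>
    using that by (auto intro!: poly_mapping_eqI simp: e0)
  have key: "(hv_deg b - hv_deg a) * Poly_Mapping.lookup (E (hv_basis b)) a
      = Poly_Mapping.lookup (hv_bracket (hv_basis b) e) a" if "hv_deg b \<in> \<Gamma>" for a b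
  proof -
    have b: "hv_basis b \<in> V" using that by (rule hv_space_closed)
    have "hv_bracket (hv_basis b) (hv_basis (L 0 0)) = hv_scale (hv_deg b) (hv_basis b)"
      by (cases b) auto
    then have "hv_scale (hv_deg b) (E (hv_basis b))
        = hv_bracket (E (hv_basis b)) (hv_basis (L 0 0)) + hv_bracket (hv_basis b) e"
      using derivationD(3,4)[OF E] b L0 by (metis e_def)
    from arg_cong[OF this, of "\<lambda>p. Poly_Mapping.lookup p a"] show ?thesis
      by (simp add: lookup_add lookup_bracket_L0 algebra_simps)
  qed
  have be: "lc (hv_bracket (hv_basis b) e) \<gamma> = 0" "hc (hv_bracket (hv_basis b) e) \<gamma> = 0"
    if "\<gamma> \<noteq> hv_deg b" for b \<gamma>
    using that by (cases b; simp add: coeff_bracket_left lce)+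
  have off: "Poly_Mapping.lookup (E (hv_basis b)) a = 0"
    if "hv_deg b \<in> \<Gamma>" "hv_deg a \<noteq> hv_deg b" for a b
  proof -
    have "Poly_Mapping.lookup (hv_bracket (hv_basis b) e) a = 0"
      using be[OF that(2)] by (cases a) (metis hv_index.sel lookup_lc lookup_hc lookup_zero)+
    then show ?thesis using key[OF that(1)] that(2) by (metis eq_iff_diff_eq_0 mult_eq_0_iff)
  qed
  have offc: "lc (E (hv_basis b)) \<gamma> = 0" "hc (E (hv_basis b)) \<gamma> = 0"
    if "hv_deg b \<in> \<Gamma>" "\<gamma> \<noteq> hv_deg b" for b \<gamma>
    using that by (auto intro!: poly_mapping_eqI simp: off)
  \<comment> \<open>The part of E that would send H to L in the same degree.\<close>
  define h where "h = (\<lambda>\<beta> j. lc (E (hv_basis (H \<beta> j))) \<beta>)"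
  have rel: "mon 0 \<beta> * h (\<alpha> + \<beta>) (i + j) = mon i (\<beta> - \<alpha>) * h \<beta> j" if "\<alpha> \<in> \<Gamma>" "\<beta> \<in> \<Gamma>" for \<alpha> \<beta> i j
  proof -
    have in_V: "hv_basis (L \<alpha> i) \<in> V" "hv_basis (H \<beta> j) \<in> V" "hv_basis (H (\<alpha> + \<beta>) (i + j)) \<in> V"
      using that by (auto intro!: hv_space_closed subgroup_closed)
    have "hv_bracket (hv_basis (L \<alpha> i)) (hv_basis (H \<beta> j))
        = hv_scale (- \<beta>) (hv_basis (H (\<alpha> + \<beta>) (i + j)))" by simp
    then have "hv_scale (- \<beta>) (E (hv_basis (H (\<alpha> + \<beta>) (i + j))))
      = hv_bracket (E (hv_basis (L \<alpha> i))) (hv_basis (H \<beta> j))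
        + hv_bracket (hv_basis (L \<alpha> i)) (E (hv_basis (H \<beta> j)))"
      using derivationD(3,4)[OF E] in_V by metis
    from arg_cong[OF this, of "\<lambda>x. lc x (\<alpha> + \<beta>)"] show ?thesis
      by (simp add: h_def coeff_bracket_left single_uminus single_diff left_diff_distrib
          flip: minus_mult_left)
        (metis add.inverse_inverse minus_diff_eq)
  qed
  have h: "h \<beta> j = 0" if "\<beta> \<in> \<Gamma>" for \<beta> j
  proof (cases "\<beta> = 0")
    case True
    obtain \<alpha> where "\<alpha> \<in> \<Gamma>" "\<alpha> \<noteq> 0" by (rule obtain_nonzero)
    then show ?thesis using rel[of \<alpha> 0 0 j] True by (simp add: subgroup_closed)
  next
    case False
    have "h (\<beta> + \<beta>) j = 0" using rel[of \<beta> \<beta> 0 j] that False by simp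
    then show ?thesis
      using rel[of "- \<beta>" "\<beta> + \<beta>" 0 j] that False subgroup_closed(2)[OF that that]
      by (simp add: subgroup_closed(3))
  qed
  have "lc (E (hv_basis (H \<beta> j))) \<gamma> = 0" if "\<beta> \<in> \<Gamma>" for \<beta> j \<gamma>
    using h[OF that, of j] offc(1)[of "H \<beta> j" \<gamma>] that by (cases "\<gamma> = \<beta>") (auto simp: h_def)
  then have dp: "degree_preserving E"
    unfolding degree_preserving_def using offc by simp
  have u0: "lc u 0 = 0" "hc u 0 = 0"
    by (auto intro!: poly_mapping_eqI simp: lu)
  have "D x = hv_bracket u x + E x" for x by (simp add: E_def)
  then show ?thesis by (rule that[OF u u0 E dp])
qed

section \<open>Degree-preserving derivations that kill t L(0)\<close>

lemma derivation_rel: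
  assumes "derivation E" "hv_deg a \<in> \<Gamma>" "hv_deg b \<in> \<Gamma>"
    and "hv_basis_bracket a b = hv_scale c (hv_basis e)" "hv_deg e \<in> \<Gamma>"
  shows "hv_scale c (E (hv_basis e))
      = hv_bracket (E (hv_basis a)) (hv_basis b) + hv_bracket (hv_basis a) (E (hv_basis b))"
proof -
  have "hv_bracket (hv_basis a) (hv_basis b) = hv_scale c (hv_basis e)"
    by (simp add: assms(4) del: hv_scale_single)
  from arg_cong[OF this, of E] show ?thesis
    by (simp add: derivationD(3,4)[OF assms(1)] hv_space_closed(1) assms(2,3,5) del: hv_scale_single hv_bracket_basis)
qed

text \<open>
  Comparing coefficients in the images of \<open>[t\<^sup>i L\<^sub>\<alpha>, t\<^sup>j L\<^sub>\<beta>]\<close> and \<open>[t\<^sup>i L\<^sub>\<alpha>, t\<^sup>j H\<^sub>\<beta>]\<close> gives cocycle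
  identities. With \<open>E (t L\<^sub>0) = 0\<close> they say that \<open>E\<close> commutes with multiplication by \<open>t\<close>, that \<open>c\<close> is
  additive, and that \<open>(\<alpha> - \<beta>) d(\<alpha> + \<beta>) = \<alpha> d(\<alpha>) - \<beta> d(\<beta>)\<close>. Only the values on multiples of a degree
  are recorded for \<open>c\<close> and \<open>d\<close>, as these suffice for passing from \<open>\<omega> = n \<alpha>\<close> to \<open>\<alpha>\<close>.
\<close>

lemma degree_preserving_form:
  assumes E: "derivation E" and dp: "degree_preserving E" and E0: "E (hv_basis (L 0 1)) = 0"
  obtains c d h where
    "\<And>x \<gamma>. x \<in> V \<Longrightarrow> lc (E x) \<gamma> = c \<gamma> * lc x \<gamma>"
    "\<And>x \<gamma>. x \<in> V \<Longrightarrow> hc (E x) \<gamma> = d \<gamma> * lc x \<gamma> + (c \<gamma> + h) * hc x \<gamma>"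
    "\<And>n \<alpha>. \<alpha> \<in> \<Gamma> \<Longrightarrow> c (of_nat n * \<alpha>) = of_nat n * c \<alpha>"
    "\<And>n \<alpha>. \<alpha> \<in> \<Gamma> \<Longrightarrow> d (of_nat n * \<alpha>) = of_nat n * d \<alpha>"
proof -
  define c' where "c' = (\<lambda>\<alpha> i. lc (E (hv_basis (L \<alpha> i))) \<alpha>)"
  define d' where "d' = (\<lambda>\<alpha> i. hc (E (hv_basis (L \<alpha> i))) \<alpha>)"
  define h' where "h' = (\<lambda>\<alpha> i. hc (E (hv_basis (H \<alpha> i))) \<alpha>)"
  obtain \<alpha>\<^sub>0 where \<alpha>\<^sub>0: "\<alpha>\<^sub>0 \<in> \<Gamma>" "\<alpha>\<^sub>0 \<noteq> 0" by (rule obtain_nonzero)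
  have double: "2 * \<alpha> \<in> \<Gamma>" if "\<alpha> \<in> \<Gamma>" for \<alpha>
    using subgroup_multiple[OF that, of 2] by simp
  have deg: "\<alpha> + \<beta> - 2 * \<beta> = \<alpha> - \<beta>" "2 * \<alpha> - (\<alpha> + \<beta>) = \<alpha> - \<beta>" "\<alpha> + \<beta> - \<alpha> = \<beta>" for \<alpha> \<beta> :: 'a
    by simp_all
  have LL: "mon 0 (\<alpha> - \<beta>) * c' (\<alpha> + \<beta>) (i + j)
      = mon 0 (\<alpha> - \<beta>) * (mon j 1 * c' \<alpha> i + mon i 1 * c' \<beta> j)"
    and LLd: "mon 0 (\<alpha> - \<beta>) * d' (\<alpha> + \<beta>) (i + j)
      = mon 0 \<alpha> * mon j 1 * d' \<alpha> i - mon 0 \<beta> * mon i 1 * d' \<beta> j"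
    if "\<alpha> \<in> \<Gamma>" "\<beta> \<in> \<Gamma>" for \<alpha> \<beta> i j
  proof -
    have eq: "hv_scale (\<alpha> - \<beta>) (E (hv_basis (L (\<alpha> + \<beta>) (i + j))))
      = hv_bracket (E (hv_basis (L \<alpha> i))) (hv_basis (L \<beta> j))
        + hv_bracket (hv_basis (L \<alpha> i)) (E (hv_basis (L \<beta> j)))"
      by (intro derivation_rel[OF E]) (use that in \<open>auto simp: subgroup_closed\<close>)
    show "mon 0 (\<alpha> - \<beta>) * c' (\<alpha> + \<beta>) (i + j)
      = mon 0 (\<alpha> - \<beta>) * (mon j 1 * c' \<alpha> i + mon i 1 * c' \<beta> j)"
      using arg_cong[OF eq, of "\<lambda>x. lc x (\<alpha> + \<beta>)"]
      by (simp add: coeff_bracket_left deg c'_def mon_split[of i "\<alpha> - \<beta>"]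
          mon_split[of j "\<alpha> - \<beta>"] mult.assoc distrib_left)
    show "mon 0 (\<alpha> - \<beta>) * d' (\<alpha> + \<beta>) (i + j)
      = mon 0 \<alpha> * mon j 1 * d' \<alpha> i - mon 0 \<beta> * mon i 1 * d' \<beta> j"
      using arg_cong[OF eq, of "\<lambda>x. hc x (\<alpha> + \<beta>)"]
      by (simp add: coeff_bracket_left deg d'_def single_uminus mult_single)
  qed
  have LH: "h' (\<alpha> + \<beta>) (i + j) = mon j 1 * c' \<alpha> i + mon i 1 * h' \<beta> j"
    if "\<alpha> \<in> \<Gamma>" "\<beta> \<in> \<Gamma>" "\<beta> \<noteq> 0" for \<alpha> \<beta> i j
  proof -
    have eq: "hv_scale (- \<beta>) (E (hv_basis (H (\<alpha> + \<beta>) (i + j))))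
      = hv_bracket (E (hv_basis (L \<alpha> i))) (hv_basis (H \<beta> j))
        + hv_bracket (hv_basis (L \<alpha> i)) (E (hv_basis (H \<beta> j)))"
      by (intro derivation_rel[OF E]) (use that in \<open>auto simp: subgroup_closed\<close>)
    have "mon 0 (- \<beta>) * h' (\<alpha> + \<beta>) (i + j) = mon 0 (- \<beta>) * (mon j 1 * c' \<alpha> i + mon i 1 * h' \<beta> j)"
      using arg_cong[OF eq, of "\<lambda>x. hc x (\<alpha> + \<beta>)"]
      by (simp add: coeff_bracket_left deg h'_def c'_def mon_split[of i "- \<beta>"]
          mon_split[of j "- \<beta>"] mult.assoc distrib_left del: hv.scale_minus_left)
    then show ?thesis using that(3) by simp
  qed
  have LLc: "c' (\<alpha> + \<beta>) (i + j) = mon j 1 * c' \<alpha> i + mon i 1 * c' \<beta> j"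
    if "\<alpha> \<in> \<Gamma>" "\<beta> \<in> \<Gamma>" "\<alpha> \<noteq> \<beta>" for \<alpha> \<beta> i j
    using LL[OF that(1,2), of i j] that(3) by simp
  have zero1: "c' 0 1 = 0" "d' 0 1 = 0" by (simp_all add: c'_def d'_def E0)
  \<comment> \<open>Bracketing with t L(0), which E kills, raises the exponent by one.\<close>
  have c'_ne: "c' \<alpha> i = mon i 1 * c' \<alpha> 0" if \<alpha>: "\<alpha> \<in> \<Gamma>" "\<alpha> \<noteq> 0" for \<alpha> i
  proof -
    have step: "c' \<alpha> (i + 1) = mon 1 1 * c' \<alpha> i" for i
      using LLc[of \<alpha> 0 i 1] \<alpha> zero1 by (simp add: subgroup_closed)
    show ?thesis
    proof (induction i rule: int_induct[of _ 0])
      case base then show ?case by simp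
    next
      case (step1 i)
      have "c' \<alpha> (i + 1) = mon 1 1 * mon i 1 * c' \<alpha> 0" by (simp only: step step1.IH mult.assoc)
      then show ?case by (simp add: mult_single add.commute)
    next
      case (step2 i)
      have "c' \<alpha> (i - 1) = mon (-1) 1 * c' \<alpha> i"
        using step[of "i - 1"] by (simp add: mult_single flip: mult.assoc)
      also have "\<dots> = mon (-1) 1 * mon i 1 * c' \<alpha> 0" by (simp only: step2.IH mult.assoc)
      finally show ?case by (simp add: mult_single)
    qed
  qed
  have c'_0: "c' 0 i = 0" for i
    using LLc[of \<alpha>\<^sub>0 0 0 i] \<alpha>\<^sub>0 c'_ne[OF \<alpha>\<^sub>0, of i] by (simp add: subgroup_closed)
  define c where "c = (\<lambda>\<alpha>. c' \<alpha> 0)"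
  have c': "c' \<alpha> i = mon i 1 * c \<alpha>" if "\<alpha> \<in> \<Gamma>" for \<alpha> i
    using c'_ne[OF that, of i] c'_0[of i] c'_0[of 0] by (cases "\<alpha> = 0") (auto simp: c_def)
  have c_add: "c (\<alpha> + \<beta>) = c \<alpha> + c \<beta>" if "\<alpha> \<in> \<Gamma>" "\<beta> \<in> \<Gamma>" "\<alpha> \<noteq> \<beta>" for \<alpha> \<beta>
    using LLc[OF that, of 0 0] by (simp add: c_def)
  have c_0: "c 0 = 0" by (simp add: c_def c'_0)
  have c_neg: "c (- \<alpha>) = - c \<alpha>" if "\<alpha> \<in> \<Gamma>" for \<alpha>
    using c_add[of \<alpha> "- \<alpha>"] that c_0
    by (cases "\<alpha> = 0") (auto simp: subgroup_closed eq_neg_iff_add_eq_0 add.commute)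
  \<comment> \<open>The cocycle identity is void for equal degrees; 2a + (-a) = a replaces it.\<close>
  have c_double: "c (\<alpha> + \<alpha>) = c \<alpha> + c \<alpha>" if "\<alpha> \<in> \<Gamma>" for \<alpha>
  proof (cases "\<alpha> = 0")
    case False
    then have "\<alpha> + \<alpha> \<noteq> - \<alpha>"
      using mult_eq_0_iff[of 3 \<alpha>] by (simp add: eq_neg_iff_add_eq_0)
    then show ?thesis
      using c_add[of "\<alpha> + \<alpha>" "- \<alpha>"] c_neg[OF that] that double by (simp add: subgroup_closed)
  qed (simp add: c_0)
  have c_add': "c (\<alpha> + \<beta>) = c \<alpha> + c \<beta>" if "\<alpha> \<in> \<Gamma>" "\<beta> \<in> \<Gamma>" for \<alpha> \<beta>
    using c_add c_double that by metis
  have c_mult: "c (of_nat n * \<alpha>) = of_nat n * c \<alpha>" if "\<alpha> \<in> \<Gamma>" for n \<alpha>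
    by (induction n) (simp_all add: c_0 distrib_right c_add' that subgroup_multiple)
  define d where "d = (\<lambda>\<alpha>. d' \<alpha> 0)"
  have d'_ne: "d' \<alpha> i = mon i 1 * d \<alpha>" if "\<alpha> \<in> \<Gamma>" "\<alpha> \<noteq> 0" for \<alpha> i
    using LLd[of \<alpha> 0 0 i] that by (simp add: d_def subgroup_closed mult.assoc)
  have dneg: "mon 0 (\<alpha> - - \<alpha>) * d' 0 i = mon 0 \<alpha> * mon i 1 * (d \<alpha> + d (- \<alpha>))"
    if "\<alpha> \<in> \<Gamma>" "\<alpha> \<noteq> 0" for \<alpha> i
    using LLd[of \<alpha> "- \<alpha>" 0 i] d'_ne[of "- \<alpha>" i] that
    by (simp add: d_def subgroup_closed single_uminus algebra_simps)
  have d_neg: "d (- \<alpha>) = - d \<alpha>" if "\<alpha> \<in> \<Gamma>" "\<alpha> \<noteq> 0" for \<alpha>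
    using dneg[OF that, of 1] zero1 that by (simp add: eq_neg_iff_add_eq_0 add.commute)
  have d'_0: "d' 0 i = 0" for i
    using dneg[OF \<alpha>\<^sub>0, of i] d_neg[OF \<alpha>\<^sub>0] \<alpha>\<^sub>0 by simp
  have d': "d' \<alpha> i = mon i 1 * d \<alpha>" if "\<alpha> \<in> \<Gamma>" for \<alpha> i
    using d'_ne[OF that, of i] d'_0[of i] d'_0[of 0] by (cases "\<alpha> = 0") (auto simp: d_def)
  have d_rel: "mon 0 (\<alpha> - \<beta>) * d (\<alpha> + \<beta>) = mon 0 \<alpha> * d \<alpha> - mon 0 \<beta> * d \<beta>"
    if "\<alpha> \<in> \<Gamma>" "\<beta> \<in> \<Gamma>" for \<alpha> \<beta>
    using LLd[OF that, of 0 0] by (simp add: d_def)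
  have d_mult: "d (of_nat n * \<alpha>) = of_nat n * d \<alpha>" if \<alpha>: "\<alpha> \<in> \<Gamma>" for n \<alpha>
  proof (cases "\<alpha> = 0")
    case True then show ?thesis using d'_0 by (simp add: d_def)
  next
    case False
    have m: "mon 0 (of_nat k * \<alpha>) = of_nat k * mon 0 \<alpha>" for k
      by (simp add: single_of_nat mult_single flip: single_of_nat)
    show ?thesis
    proof (induction n)
      case 0 then show ?case using d'_0 by (simp add: d_def)
    next
      case (Suc n)
      show ?case
      \<comment> \<open>The identity for d at (n a, a) is void for n = 1; the one at (2a, -a) takes its place.\<close>
      proof (cases "n = 1")
        case True
        have "mon 0 (of_nat 3 * \<alpha>) * d \<alpha> = mon 0 (of_nat 2 * \<alpha>) * d (\<alpha> + \<alpha>) - mon 0 \<alpha> * d \<alpha>"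
          using d_rel[of "\<alpha> + \<alpha>" "- \<alpha>"] d_neg[OF \<alpha> False] \<alpha> double[OF \<alpha>]
          by (simp add: subgroup_closed single_uminus algebra_simps)
        then have "d (\<alpha> + \<alpha>) = 2 * d \<alpha>"
          unfolding m using False by (auto simp: algebra_simps)
        then show ?thesis using True by simp
      next
        case ne: False
        have "of_nat n \<noteq> (1::'a)" using ne of_nat_eq_iff[of n 1, where 'a = 'a] by simp
        then have nz: "of_nat n * \<alpha> - \<alpha> \<noteq> 0" using False by simp
        have "mon 0 (of_nat n * \<alpha> - \<alpha>) * d (of_nat n * \<alpha> + \<alpha>)
            = mon 0 (of_nat n * \<alpha>) * (of_nat n * d \<alpha>) - mon 0 \<alpha> * d \<alpha>"
          using d_rel[of "of_nat n * \<alpha>" \<alpha>] \<alpha> Suc by (simp add: subgroup_multiple)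
        also have "\<dots> = mon 0 (of_nat n * \<alpha> - \<alpha>) * (of_nat (Suc n) * d \<alpha>)"
          unfolding single_diff m by (simp add: algebra_simps)
        finally have "d (of_nat n * \<alpha> + \<alpha>) = of_nat (Suc n) * d \<alpha>"
          using nz by (simp only: mult_cancel_left mon_eq_0_iff simp_thms)
        then show ?thesis by (simp add: distrib_right add.commute)
      qed
    qed
  qed
  \<comment> \<open>The action on H is the one on L up to a constant, read off at one nonzero degree.\<close>
  define h where "h = h' \<alpha>\<^sub>0 0 - c \<alpha>\<^sub>0"
  have h': "h' \<gamma> i = mon i 1 * (c \<gamma> + h)" if "\<gamma> \<in> \<Gamma>" for \<gamma> i
    using LH[of "\<gamma> - \<alpha>\<^sub>0" \<alpha>\<^sub>0 i 0] \<alpha>\<^sub>0 that c'[of "\<gamma> - \<alpha>\<^sub>0" i] c_add'[of \<gamma> "- \<alpha>\<^sub>0"] c_neg[of \<alpha>\<^sub>0]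
    by (simp add: subgroup_closed h_def distrib_left right_diff_distrib)
  have basis: "lc (E (hv_basis a)) \<gamma> = c \<gamma> * lc (hv_basis a) \<gamma>"
    "hc (E (hv_basis a)) \<gamma> = d \<gamma> * lc (hv_basis a) \<gamma> + (c \<gamma> + h) * hc (hv_basis a) \<gamma>"
    if "hv_deg a \<in> \<Gamma>" for a \<gamma>
  proof -
    have *: "\<alpha> \<in> \<Gamma> \<Longrightarrow> \<gamma> \<noteq> \<alpha> \<Longrightarrow> lc (E (hv_basis (L \<alpha> i))) \<gamma> = 0"
      "\<alpha> \<in> \<Gamma> \<Longrightarrow> \<gamma> \<noteq> \<alpha> \<Longrightarrow> hc (E (hv_basis (L \<alpha> i))) \<gamma> = 0"
      "\<alpha> \<in> \<Gamma> \<Longrightarrow> lc (E (hv_basis (H \<alpha> i))) \<gamma> = 0"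
      "\<alpha> \<in> \<Gamma> \<Longrightarrow> \<gamma> \<noteq> \<alpha> \<Longrightarrow> hc (E (hv_basis (H \<alpha> i))) \<gamma> = 0" for \<alpha> i
      using dp unfolding degree_preserving_def by auto
    show "lc (E (hv_basis a)) \<gamma> = c \<gamma> * lc (hv_basis a) \<gamma>"
      using that * c' by (cases a) (auto simp: c'_def mult.commute)
    show "hc (E (hv_basis a)) \<gamma> = d \<gamma> * lc (hv_basis a) \<gamma> + (c \<gamma> + h) * hc (hv_basis a) \<gamma>"
      using that * d' h' by (cases a) (auto simp: d'_def h'_def mult.commute)
  qed
  have lcE: "lc (E x) \<gamma> = c \<gamma> * lc x \<gamma>" if "x \<in> V" for x \<gamma>
    using that by (induction rule: hv_space_induct)
      (simp_all only: basis derivationD[OF E] coeff_simps(3,9) algebra_simps)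
  have hcE: "hc (E x) \<gamma> = d \<gamma> * lc x \<gamma> + (c \<gamma> + h) * hc x \<gamma>" if "x \<in> V" for x \<gamma>
    using that by (induction rule: hv_space_induct)
      (simp_all only: basis derivationD[OF E] coeff_simps(3,4,9,10) algebra_simps)
  show ?thesis by (rule that[OF lcE hcE c_mult d_mult])
qed

section \<open>The normalizer of a probe\<close>

text \<open>
  Write \<open>D = ad u + E\<close> with \<open>E\<close> preserving degrees. In the degrees where \<open>D (probe \<omega> \<alpha>)\<close> is known to
  vanish, the coefficients of \<open>u\<close> satisfy two-term recursions in steps of \<open>\<omega>\<close>, disturbed only at
  the degrees \<open>0\<close>, \<open>\<omega>\<close>, \<open>\<alpha>\<close> and \<open>\<omega> + \<alpha>\<close>. A nonzero coefficient elsewhere would propagate forever in one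
  direction, so \<open>u = p L\<^sub>\<omega> + q H\<^sub>\<alpha>\<close>, and \<open>p = q\<close> by the equation in degree \<open>\<omega> + \<alpha>\<close>. The component in
  degree \<open>0\<close> then says \<open>E (t L\<^sub>0) = 0\<close>.
\<close>

lemma normalizer_of_probe:
  assumes D: "derivation D" and \<alpha>: "\<alpha> \<in> \<Gamma>" "\<alpha> \<noteq> 0" and n: "n \<ge> 2" and \<omega>: "\<omega> = of_nat n * \<alpha>"
    and lcD: "\<And>\<gamma>. \<gamma> \<noteq> \<omega> \<Longrightarrow> lc (D (probe \<omega> \<alpha>)) \<gamma> = 0"
    and hcD: "\<And>\<gamma>. \<gamma> \<noteq> \<omega> \<Longrightarrow> \<gamma> \<noteq> \<alpha> \<Longrightarrow> hc (D (probe \<omega> \<alpha>)) \<gamma> = 0"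
  obtains p c d h where
    "\<And>x \<gamma>. x \<in> V \<Longrightarrow> lc (D x) \<gamma> = mon 0 (2 * \<omega> - \<gamma>) * lc x (\<gamma> - \<omega>) * p + c \<gamma> * lc x \<gamma>"
    "\<And>x \<gamma>. x \<in> V \<Longrightarrow> hc (D x) \<gamma> = mon 0 (\<omega> - \<gamma>) * hc x (\<gamma> - \<omega>) * p + mon 0 \<alpha> * lc x (\<gamma> - \<alpha>) * p
      + d \<gamma> * lc x \<gamma> + (c \<gamma> + h) * hc x \<gamma>"
    "\<And>n \<alpha>. \<alpha> \<in> \<Gamma> \<Longrightarrow> c (of_nat n * \<alpha>) = of_nat n * c \<alpha>"
    "\<And>n \<alpha>. \<alpha> \<in> \<Gamma> \<Longrightarrow> d (of_nat n * \<alpha>) = of_nat n * d \<alpha>"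
proof -
  obtain u E where u: "u \<in> V" "lc u 0 = 0" "hc u 0 = 0" and E: "derivation E" "degree_preserving E"
    and DuE: "\<And>x. D x = hv_bracket u x + E x"
    using derivation_inner_plus_degree_preserving[OF D] by metis
  have \<omega>_in: "\<omega> \<in> \<Gamma>" unfolding \<omega> using \<alpha>(1) by (rule subgroup_multiple)
  have mult_eq: "of_nat k * \<alpha> = of_nat m * \<alpha> \<longleftrightarrow> k = m" for k m using \<alpha>(2) by simp
  have ne: "\<omega> \<noteq> 0" "\<omega> \<noteq> \<alpha>" "\<omega> + \<alpha> \<noteq> 0" "- \<omega> \<noteq> \<omega>" "- \<omega> \<noteq> \<alpha>" "- \<alpha> \<noteq> \<omega>"
    using mult_eq[of n 0] mult_eq[of n 1] mult_eq[of "n + 1" 0] mult_eq[of "n + n" 0] n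
    by (auto simp: \<omega> algebra_simps minus_equation_iff neg_eq_iff_add_eq_0 simp del: of_nat_add)
  have dp: "\<beta> \<in> \<Gamma> \<Longrightarrow> \<gamma> \<noteq> \<beta> \<Longrightarrow> lc (E (hv_basis (L \<beta> i))) \<gamma> = 0"
    "\<beta> \<in> \<Gamma> \<Longrightarrow> \<gamma> \<noteq> \<beta> \<Longrightarrow> hc (E (hv_basis (L \<beta> i))) \<gamma> = 0"
    "\<beta> \<in> \<Gamma> \<Longrightarrow> lc (E (hv_basis (H \<beta> i))) \<gamma> = 0"
    "\<beta> \<in> \<Gamma> \<Longrightarrow> \<gamma> \<noteq> \<beta> \<Longrightarrow> hc (E (hv_basis (H \<beta> i))) \<gamma> = 0" for \<beta> \<gamma> i
    using E(2) unfolding degree_preserving_def by auto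
  have Ey: "E (probe \<omega> \<alpha>) = E (hv_basis (L 0 1)) + E (hv_basis (L \<omega> 0)) + E (hv_basis (H \<alpha> 0))"
    unfolding probe_def using \<alpha>(1) \<omega>_in
    by (simp add: derivationD(2)[OF E(1)] hv_space_closed(1,2) subgroup_closed(1))
  have lcy: "lc (D (probe \<omega> \<alpha>)) \<gamma> =
      mon 1 \<gamma> * lc u \<gamma> + mon 0 (\<gamma> - 2 * \<omega>) * lc u (\<gamma> - \<omega>) + lc (E (probe \<omega> \<alpha>)) \<gamma>" for \<gamma>
    by (simp add: DuE) (simp add: probe_def hv_bracket_add_right)
  have hcy: "hc (D (probe \<omega> \<alpha>)) \<gamma> =
      mon 1 \<gamma> * hc u \<gamma> + mon 0 (\<gamma> - \<omega>) * hc u (\<gamma> - \<omega>) + mon 0 (- \<alpha>) * lc u (\<gamma> - \<alpha>)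
        + hc (E (probe \<omega> \<alpha>)) \<gamma>" for \<gamma>
    by (simp add: DuE) (simp add: probe_def hv_bracket_add_right)
  have lcE: "lc (E (probe \<omega> \<alpha>)) \<gamma> = 0" if "\<gamma> \<noteq> 0" "\<gamma> \<noteq> \<omega>" for \<gamma>
    using that \<alpha>(1) \<omega>_in by (simp add: Ey dp subgroup_closed(1))
  have hcE: "hc (E (probe \<omega> \<alpha>)) \<gamma> = 0" if "\<gamma> \<noteq> 0" "\<gamma> \<noteq> \<omega>" "\<gamma> \<noteq> \<alpha>" for \<gamma>
    using that \<alpha>(1) \<omega>_in by (simp add: Ey dp subgroup_closed(1))
  \<comment> \<open>A chain descending by omega cannot step from 2 omega to omega, since the factor gamma - 2 omega
      vanishes there.\<close>
  have "{\<gamma>. \<gamma> \<noteq> \<omega> \<and> lc u \<gamma> \<noteq> 0} = {}"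
  proof (rule finite_shift_closed_empty)
    show "finite {\<gamma>. \<gamma> \<noteq> \<omega> \<and> lc u \<gamma> \<noteq> 0}"
      using finite_coeff_support(1)[of u] by (rule rev_finite_subset) auto
    fix \<gamma> assume "\<gamma> \<in> {\<gamma>. \<gamma> \<noteq> \<omega> \<and> lc u \<gamma> \<noteq> 0}"
    then have \<gamma>: "\<gamma> \<noteq> \<omega>" "lc u \<gamma> \<noteq> 0" "\<gamma> \<noteq> 0" using u by auto
    then have eq: "mon 1 \<gamma> * lc u \<gamma> + mon 0 (\<gamma> - 2 * \<omega>) * lc u (\<gamma> - \<omega>) = 0"
      using lcy[of \<gamma>] lcE[of \<gamma>] lcD[of \<gamma>] by simp
    have "mon 0 (\<gamma> - 2 * \<omega>) * lc u (\<gamma> - \<omega>) \<noteq> 0"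
    proof
      assume "mon 0 (\<gamma> - 2 * \<omega>) * lc u (\<gamma> - \<omega>) = 0"
      with eq \<gamma> show False by simp
    qed
    then show "\<gamma> + - \<omega> \<in> {\<gamma>. \<gamma> \<noteq> \<omega> \<and> lc u \<gamma> \<noteq> 0}" by auto
  qed (use ne in simp)
  then have lcu: "lc u \<gamma> = (if \<gamma> = \<omega> then lc u \<omega> else 0)" for \<gamma> by auto
  have hceq: "mon 1 \<gamma> * hc u \<gamma> + mon 0 (\<gamma> - \<omega>) * hc u (\<gamma> - \<omega>) + mon 0 (- \<alpha>) * lc u (\<gamma> - \<alpha>) = 0"
    if "\<gamma> \<noteq> 0" "\<gamma> \<noteq> \<omega>" "\<gamma> \<noteq> \<alpha>" for \<gamma>
    using hcy[of \<gamma>] hcE[OF that] hcD[OF that(2,3)] by simp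
  \<comment> \<open>The disturbed degrees lie on the line through alpha, at multiples 0, 1, n and n + 1. On the negative
      multiples the recursion is therefore followed downwards, everywhere else upwards.\<close>
  define N where "N = {- (of_nat k * \<alpha>) | k. k \<ge> 1}"
  have N_shift: "\<gamma> - \<omega> \<in> N" if \<gamma>N: "\<gamma> \<in> N" for \<gamma>
  proof -
    obtain k where "k \<ge> 1" "\<gamma> = - (of_nat k * \<alpha>)" using \<gamma>N by (auto simp: N_def)
    then show ?thesis
      unfolding N_def by (intro CollectI exI[of _ "k + n"]) (simp add: \<omega> algebra_simps)
  qed
  have N_mem: "- \<omega> \<in> N" "\<alpha> - \<omega> \<in> N"
  proof -
    show "- \<omega> \<in> N" unfolding N_def \<omega> using n by (intro CollectI exI[of _ n]) simp
    have "\<alpha> - \<omega> = - (of_nat (n - 1) * \<alpha>)"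
      using n by (simp add: \<omega> of_nat_diff left_diff_distrib)
    then show "\<alpha> - \<omega> \<in> N" unfolding N_def using n by (intro CollectI exI[of _ "n - 1"]) simp
  qed
  have N_ne: "\<gamma> \<noteq> 0" "\<gamma> \<noteq> \<omega>" "\<gamma> \<noteq> \<alpha>" "\<gamma> - \<alpha> \<noteq> \<omega>" if \<gamma>N: "\<gamma> \<in> N" for \<gamma>
  proof -
    obtain k where k: "k \<ge> 1" "\<gamma> = - (of_nat k * \<alpha>)" using \<gamma>N by (auto simp: N_def)
    have shift: "\<gamma> - of_nat m * \<alpha> \<noteq> 0" for m
    proof -
      have "\<gamma> - of_nat m * \<alpha> = - (of_nat (k + m) * \<alpha>)" using k(2) by (simp add: algebra_simps)
      then show ?thesis using mult_eq[of "k + m" 0] k(1) by (simp del: of_nat_add)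
    qed
    show "\<gamma> \<noteq> 0" "\<gamma> \<noteq> \<omega>" "\<gamma> \<noteq> \<alpha>" "\<gamma> - \<alpha> \<noteq> \<omega>"
      using shift[of 0] shift[of n] shift[of 1] shift[of "n + 1"] by (auto simp: \<omega> algebra_simps)
  qed
  have up: "{\<gamma>. \<gamma> \<noteq> \<alpha> \<and> \<gamma> \<notin> N \<and> hc u \<gamma> \<noteq> 0} = {}"
  proof (rule finite_shift_closed_empty)
    show "finite {\<gamma>. \<gamma> \<noteq> \<alpha> \<and> \<gamma> \<notin> N \<and> hc u \<gamma> \<noteq> 0}"
      using finite_coeff_support(2)[of u] by (rule rev_finite_subset) auto
    fix \<gamma> assume "\<gamma> \<in> {\<gamma>. \<gamma> \<noteq> \<alpha> \<and> \<gamma> \<notin> N \<and> hc u \<gamma> \<noteq> 0}"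
    then have \<gamma>: "\<gamma> \<noteq> \<alpha>" "\<gamma> \<notin> N" "hc u \<gamma> \<noteq> 0" "\<gamma> \<noteq> 0" using u by auto
    have \<gamma>': "\<gamma> + \<omega> \<noteq> 0" "\<gamma> + \<omega> \<noteq> \<omega>" "\<gamma> + \<omega> \<noteq> \<alpha>" "\<gamma> + \<omega> - \<alpha> \<noteq> \<omega>" "\<gamma> + \<omega> \<notin> N"
      using \<gamma> N_mem N_shift[of "\<gamma> + \<omega>"] by (auto simp: eq_neg_iff_add_eq_0[symmetric] eq_diff_eq[symmetric])
    have "mon 1 (\<gamma> + \<omega>) * hc u (\<gamma> + \<omega>) + mon 0 \<gamma> * hc u \<gamma> = 0"
      using hceq[OF \<gamma>'(1-3)] \<gamma>'(4) lcu[of "\<gamma> + \<omega> - \<alpha>"] by simp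
    then have "hc u (\<gamma> + \<omega>) \<noteq> 0" using \<gamma> by auto
    then show "\<gamma> + \<omega> \<in> {\<gamma>. \<gamma> \<noteq> \<alpha> \<and> \<gamma> \<notin> N \<and> hc u \<gamma> \<noteq> 0}" using \<gamma>' by simp
  qed (rule ne)
  have down: "{\<gamma>. \<gamma> \<in> N \<and> hc u \<gamma> \<noteq> 0} = {}"
  proof (rule finite_shift_closed_empty)
    show "finite {\<gamma>. \<gamma> \<in> N \<and> hc u \<gamma> \<noteq> 0}"
      using finite_coeff_support(2)[of u] by (rule rev_finite_subset) auto
    fix \<gamma> assume "\<gamma> \<in> {\<gamma>. \<gamma> \<in> N \<and> hc u \<gamma> \<noteq> 0}"
    then have \<gamma>: "\<gamma> \<in> N" "hc u \<gamma> \<noteq> 0" by auto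
    have "mon 1 \<gamma> * hc u \<gamma> + mon 0 (\<gamma> - \<omega>) * hc u (\<gamma> - \<omega>) = 0"
      using hceq[OF N_ne(1-3)[OF \<gamma>(1)]] N_ne(4)[OF \<gamma>(1)] lcu[of "\<gamma> - \<alpha>"] by simp
    then have "hc u (\<gamma> - \<omega>) \<noteq> 0" using \<gamma> N_ne(1)[OF \<gamma>(1)] by auto
    then show "\<gamma> + - \<omega> \<in> {\<gamma>. \<gamma> \<in> N \<and> hc u \<gamma> \<noteq> 0}" using N_shift[OF \<gamma>(1)] by simp
  qed (use ne in simp)
  have hcu0: "hc u \<gamma> = 0" if "\<gamma> \<noteq> \<alpha>" for \<gamma> using up down that by blast
  have "hc u \<alpha> = lc u \<omega>"
  proof -
    have "mon 0 \<alpha> * hc u \<alpha> - mon 0 \<alpha> * lc u \<omega> = 0"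
      using hceq[of "\<omega> + \<alpha>"] ne \<alpha>(2) hcu0[of "\<omega> + \<alpha>"] by (simp add: single_uminus)
    then have "mon 0 \<alpha> * (hc u \<alpha> - lc u \<omega>) = 0" by (simp add: right_diff_distrib)
    then show ?thesis using \<alpha>(2) by simp
  qed
  then have hcu: "hc u \<gamma> = (if \<gamma> = \<alpha> then lc u \<omega> else 0)" for \<gamma> using hcu0 by auto
  have E0: "E (hv_basis (L 0 1)) = 0"
  proof (rule hv_eqI)
    fix \<gamma>
    have "lc (E (probe \<omega> \<alpha>)) 0 = 0" "hc (E (probe \<omega> \<alpha>)) 0 = 0"
      using lcy[of 0] hcy[of 0] lcD[of 0] hcD[of 0] ne \<alpha>(2) lcu[of "- \<omega>"] lcu[of "- \<alpha>"] hcu[of "- \<omega>"]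
      by simp_all
    then have "lc (E (hv_basis (L 0 1))) 0 = 0" "hc (E (hv_basis (L 0 1))) 0 = 0"
      using ne \<alpha> \<omega>_in by (simp_all add: Ey dp)
    then show "lc (E (hv_basis (L 0 1))) \<gamma> = lc 0 \<gamma>" "hc (E (hv_basis (L 0 1))) \<gamma> = hc 0 \<gamma>"
      using dp(1,2)[OF subgroup_closed(1), of \<gamma>] by (cases "\<gamma> = 0"; simp)+
  qed
  obtain c d h where
    form: "\<And>x \<gamma>. x \<in> V \<Longrightarrow> lc (E x) \<gamma> = c \<gamma> * lc x \<gamma>"
    "\<And>x \<gamma>. x \<in> V \<Longrightarrow> hc (E x) \<gamma> = d \<gamma> * lc x \<gamma> + (c \<gamma> + h) * hc x \<gamma>" and
    mult: "\<And>n \<alpha>. \<alpha> \<in> \<Gamma> \<Longrightarrow> c (of_nat n * \<alpha>) = of_nat n * c \<alpha>"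
    "\<And>n \<alpha>. \<alpha> \<in> \<Gamma> \<Longrightarrow> d (of_nat n * \<alpha>) = of_nat n * d \<alpha>"
    using degree_preserving_form[OF E E0] by metis
  note br = coeff_bracket_two_term[OF lcu hcu]
  show ?thesis
    by (rule that[of "lc u \<omega>" c d h]) (simp_all add: DuE br form mult add.assoc)
qed

section \<open>Two-local derivations\<close>

text \<open>
  For \<open>u = \<Sum> u\<^sub>\<gamma>\<close> the bracket \<open>[u, t L\<^sub>0] = \<Sum> \<gamma> t u\<^sub>\<gamma>\<close> detects every component of nonzero degree, so
  the inner part of a derivation that kills \<open>t L\<^sub>0\<close>, normalised to have no component of degree \<open>0\<close>,
  vanishes.
\<close>

lemma centralizer_of_tL0:
  assumes D: "derivation D" and D0: "D (hv_basis (L 0 1)) = 0"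
  obtains c d h where
    "\<And>x \<gamma>. x \<in> V \<Longrightarrow> lc (D x) \<gamma> = c \<gamma> * lc x \<gamma>"
    "\<And>x \<gamma>. x \<in> V \<Longrightarrow> hc (D x) \<gamma> = d \<gamma> * lc x \<gamma> + (c \<gamma> + h) * hc x \<gamma>"
    "c 0 = 0" "d 0 = 0"
proof -
  obtain u E where u: "u \<in> V" "lc u 0 = 0" "hc u 0 = 0" and E: "derivation E" "degree_preserving E"
    and DuE: "\<And>x. D x = hv_bracket u x + E x"
    using derivation_inner_plus_degree_preserving[OF D] by metis
  have off: "lc (E (hv_basis (L 0 1))) \<gamma> = 0" "hc (E (hv_basis (L 0 1))) \<gamma> = 0" if "\<gamma> \<noteq> 0" for \<gamma>
    using E(2) that subgroup_closed(1) unfolding degree_preserving_def by auto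
  have eqs: "mon 1 \<gamma> * lc u \<gamma> + lc (E (hv_basis (L 0 1))) \<gamma> = 0"
    "mon 1 \<gamma> * hc u \<gamma> + hc (E (hv_basis (L 0 1))) \<gamma> = 0" for \<gamma>
    using arg_cong[OF D0, of "\<lambda>x. lc x \<gamma>"] arg_cong[OF D0, of "\<lambda>x. hc x \<gamma>"] by (simp_all add: DuE)
  have "u = 0"
  proof (rule hv_eqI)
    fix \<gamma> show "lc u \<gamma> = lc 0 \<gamma>" "hc u \<gamma> = hc 0 \<gamma>"
      using eqs[of \<gamma>] off[of \<gamma>] u by (cases "\<gamma> = 0"; simp)+
  qed
  then have DE: "D x = E x" for x by (simp add: DuE)
  obtain c d h where
    form: "\<And>x \<gamma>. x \<in> V \<Longrightarrow> lc (E x) \<gamma> = c \<gamma> * lc x \<gamma>"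
    "\<And>x \<gamma>. x \<in> V \<Longrightarrow> hc (E x) \<gamma> = d \<gamma> * lc x \<gamma> + (c \<gamma> + h) * hc x \<gamma>" and
    mult: "\<And>n \<alpha>. \<alpha> \<in> \<Gamma> \<Longrightarrow> c (of_nat n * \<alpha>) = of_nat n * c \<alpha>"
    "\<And>n \<alpha>. \<alpha> \<in> \<Gamma> \<Longrightarrow> d (of_nat n * \<alpha>) = of_nat n * d \<alpha>"
    using degree_preserving_form[OF E] D0 DE by metis
  have "c 0 = 0" "d 0 = 0" using mult[OF subgroup_closed(1), of 0] by simp_all
  with form show ?thesis by (intro that[of c d h]) (simp_all add: DE)
qed

lemma probe_in_space: "\<omega> \<in> \<Gamma> \<Longrightarrow> \<alpha> \<in> \<Gamma> \<Longrightarrow> probe \<omega> \<alpha> \<in> V"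
  unfolding probe_def by (intro hv_space_closed) (auto simp: subgroup_closed(1))

text \<open>
  A derivation that kills the probe \<open>y\<close> is \<open>p \<cdot> ad y\<close> plus a derivation that vanishes in the degrees
  \<open>0\<close> and \<open>\<alpha>\<close>. Each degree \<open>\<beta>\<close> of \<open>x\<close> contributes to \<open>p [y, x]\<close> in degree \<open>\<omega> + \<beta>\<close>, which lies outside
  \<open>T\<close>. So if \<open>D x\<close> is again supported in \<open>T\<close>, then \<open>p = 0\<close>, or all these contributions vanish and \<open>x\<close>
  is a combination of the central elements \<open>t\<^sup>i H\<^sub>0\<close>.
\<close>

lemma centralizer_of_probe:
  assumes D: "derivation D" and \<alpha>: "\<alpha> \<in> \<Gamma>" "\<alpha> \<noteq> 0" and n: "n \<ge> 2" and \<omega>: "\<omega> = of_nat n * \<alpha>"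
    and Dy: "D (probe \<omega> \<alpha>) = 0"
    and T: "0 \<in> T" "\<And>\<beta>. \<beta> \<in> T \<Longrightarrow> \<omega> + \<beta> \<notin> T"
    and x: "x \<in> V" "\<And>\<gamma>. \<gamma> \<notin> T \<Longrightarrow> lc x \<gamma> = 0" "\<And>\<gamma>. \<gamma> \<notin> T \<Longrightarrow> hc x \<gamma> = 0"
    and Dx: "\<And>\<gamma>. \<gamma> \<notin> T \<Longrightarrow> lc (D x) \<gamma> = 0" "\<And>\<gamma>. \<gamma> \<notin> T \<Longrightarrow> hc (D x) \<gamma> = 0"
  shows "lc (D x) \<alpha> = 0" and "hc (D x) \<alpha> = 0" and "hc (D x) 0 = 0"
proof -
  obtain p c d h where
    lcD: "\<And>x \<gamma>. x \<in> V \<Longrightarrow> lc (D x) \<gamma> = mon 0 (2 * \<omega> - \<gamma>) * lc x (\<gamma> - \<omega>) * p + c \<gamma> * lc x \<gamma>" and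
    hcD: "\<And>x \<gamma>. x \<in> V \<Longrightarrow> hc (D x) \<gamma> = mon 0 (\<omega> - \<gamma>) * hc x (\<gamma> - \<omega>) * p
      + mon 0 \<alpha> * lc x (\<gamma> - \<alpha>) * p + d \<gamma> * lc x \<gamma> + (c \<gamma> + h) * hc x \<gamma>" and
    mult: "\<And>n \<alpha>. \<alpha> \<in> \<Gamma> \<Longrightarrow> c (of_nat n * \<alpha>) = of_nat n * c \<alpha>"
      "\<And>n \<alpha>. \<alpha> \<in> \<Gamma> \<Longrightarrow> d (of_nat n * \<alpha>) = of_nat n * d \<alpha>"
    by (rule normalizer_of_probe[OF D \<alpha> n \<omega>], simp add: Dy, simp add: Dy) (rule that)
  have ne: "\<omega> \<noteq> 0" "\<omega> \<noteq> \<alpha>" using \<alpha>(2) n by (auto simp: \<omega>)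
  have y: "probe \<omega> \<alpha> \<in> V" unfolding \<omega> by (intro probe_in_space subgroup_multiple \<alpha>)
  have zero: "c 0 = 0" "d 0 = 0" using mult[OF subgroup_closed(1), of 0] by simp_all
  have c\<omega>: "c \<omega> = of_nat n * c \<alpha>" and d\<omega>: "d \<omega> = of_nat n * d \<alpha>"
    using mult[OF \<alpha>(1), of n] by (simp_all add: \<omega>)
  have mon\<omega>: "mon 0 \<omega> = of_nat n * mon 0 \<alpha>"
    by (simp add: \<omega> mult_single flip: single_of_nat)
  have n0: "(of_nat n :: int \<Rightarrow>\<^sub>0 'a) \<noteq> 0" using n by simp
  \<comment> \<open>The three components of D y = 0 in the degrees omega and alpha determine c, d and h there;
      here mon 1 1 is the coefficient t of the probe in degree 0.\<close>
  have "of_nat n * (mon 0 \<alpha> * mon 1 1 * p + c \<alpha>) = 0"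
    using lcD[OF y, of \<omega>] Dy ne
    by (simp add: lc_probe mon\<omega> c\<omega> distrib_left mult.assoc)
  then have c\<alpha>: "mon 0 \<alpha> * mon 1 1 * p + c \<alpha> = 0" using n0 by (metis mult_eq_0_iff)
  have d\<alpha>: "d \<alpha> = 0"
    using hcD[OF y, of \<omega>] Dy \<alpha>(2) ne n0 by (simp add: lc_probe hc_probe d\<omega>)
  have "mon 0 \<alpha> * mon 1 1 * p + (c \<alpha> + h) = 0"
    using hcD[OF y, of \<alpha>] Dy \<alpha>(2) ne d\<alpha> by (simp add: lc_probe hc_probe)
  then have h: "h = 0" using c\<alpha> by (metis add.assoc add_0)
  have "lc (D x) \<alpha> = 0 \<and> hc (D x) \<alpha> = 0 \<and> hc (D x) 0 = 0"
  proof (cases "p = 0")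
    case True
    then show ?thesis using c\<alpha> d\<alpha> h zero by (simp add: lcD[OF x(1)] hcD[OF x(1)])
  next
    case False
    have out: "lc x (\<omega> + \<beta>) = 0" "hc x (\<omega> + \<beta>) = 0"
      "lc (D x) (\<omega> + \<beta>) = 0" "hc (D x) (\<omega> + \<beta>) = 0" if "\<beta> \<in> T" for \<beta>
      using T(2)[OF that] x(2,3) Dx by auto
    have lcx: "lc x \<beta> = 0" for \<beta>
    proof (cases "\<beta> \<in> T")
      case True
      have "mon 0 (\<omega> - \<beta>) * lc x \<beta> * p = 0"
        using lcD[OF x(1), of "\<omega> + \<beta>"] out[OF True] by simp
      then show ?thesis using False True T(2)[OF T(1)] by auto
    qed (rule x(2))
    have hcx: "hc x \<beta> = 0" if "\<beta> \<noteq> 0" for \<beta>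
    proof (cases "\<beta> \<in> T")
      case True
      have "mon 0 (- \<beta>) * hc x \<beta> * p = 0"
        using hcD[OF x(1), of "\<omega> + \<beta>"] out[OF True] lcx by simp
      then show ?thesis using False that by simp
    qed (rule x(3))
    show ?thesis
      using \<alpha>(2) ne h zero by (simp add: lcD[OF x(1)] hcD[OF x(1)] lcx hcx)
  qed
  then show "lc (D x) \<alpha> = 0" "hc (D x) \<alpha> = 0" "hc (D x) 0 = 0" by simp_all
qed

lemma infinite_grading: "infinite \<Gamma>"
proof
  assume fin: "finite \<Gamma>"
  obtain \<alpha> where \<alpha>: "\<alpha> \<in> \<Gamma>" "\<alpha> \<noteq> 0" by (rule obtain_nonzero)
  from finite_shift_closed_empty[OF fin \<alpha>(2)] \<alpha>(1) subgroup_closed(2) show False by blast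
qed

text \<open>
  Subtracting a derivation that agrees with \<open>\<Delta>\<close> at \<open>t L\<^sub>0\<close> and at the master element \<open>z\<close>, it remains to
  see that a \<open>2\<close>-local derivation which kills both of these kills everything supported in \<open>S\<close>. The
  elements \<open>x\<close> are treated through the probes, one for each nonzero degree, and the probes through
  \<open>z\<close>, which contains all of them; the term \<open>L\<^sub>\<eta>\<close> of \<open>z\<close>, whose degree is generic, detects any
  inner derivation by a multiple of a probe.
\<close>

lemma two_local_is_derivation_on_finite_support:
  assumes tl: "two_local \<Delta>" and S: "finite S" "S \<subseteq> \<Gamma>"
  obtains D where "derivation D"
    "\<And>x. x \<in> V \<Longrightarrow> (\<And>\<gamma>. \<gamma> \<notin> S \<Longrightarrow> lc x \<gamma> = 0) \<Longrightarrow> (\<And>\<gamma>. \<gamma> \<notin> S \<Longrightarrow> hc x \<gamma> = 0) \<Longrightarrow> \<Delta> x = D x"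
proof -
  obtain \<alpha>\<^sub>0 where \<alpha>\<^sub>0: "\<alpha>\<^sub>0 \<in> \<Gamma>" "\<alpha>\<^sub>0 \<noteq> 0" by (rule obtain_nonzero)
  \<comment> \<open>Including a nonzero degree guarantees a probe, which is needed to treat the degree 0.\<close>
  define T where "T = insert 0 (insert \<alpha>\<^sub>0 S)"
  define A where "A = T - {0}"
  have T: "finite T" "T \<subseteq> \<Gamma>" "0 \<in> T" "S \<subseteq> T"
    using S \<alpha>\<^sub>0 by (auto simp: T_def subgroup_closed(1))
  have A: "finite A" "A \<subseteq> \<Gamma>" "A \<subseteq> T" "0 \<notin> A" "\<alpha>\<^sub>0 \<in> A" using T \<alpha>\<^sub>0 by (auto simp: A_def T_def)
  \<comment> \<open>With this n, shifting by n alpha moves T, and in particular 0, off T.\<close>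
  obtain n where n: "n \<ge> 2" "\<And>\<alpha> \<beta>. \<alpha> \<in> A \<Longrightarrow> \<beta> \<in> T \<Longrightarrow> of_nat n * \<alpha> + \<beta> \<notin> T"
    using finite_avoiding_multiple[OF A(1) T(1) A(4)] by metis
  define \<omega> where "\<omega> = (\<lambda>\<alpha> :: 'a. of_nat n * \<alpha>)"
  have \<omega>_in: "\<omega> \<alpha> \<in> \<Gamma>" if "\<alpha> \<in> \<Gamma>" for \<alpha> unfolding \<omega>_def using that by (rule subgroup_multiple)
  have \<omega>T: "\<omega> \<alpha> + \<beta> \<notin> T" if "\<alpha> \<in> A" "\<beta> \<in> T" for \<alpha> \<beta> using n(2)[OF that] by (simp add: \<omega>_def)
  have \<omega>T0: "\<omega> \<alpha> \<notin> T" if "\<alpha> \<in> A" for \<alpha> using \<omega>T[OF that T(3)] by simp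
  have \<omega>_inj: "\<omega> \<alpha> = \<omega> \<beta> \<longleftrightarrow> \<alpha> = \<beta>" for \<alpha> \<beta> using n(1) by (auto simp: \<omega>_def)
  define M where "M = T \<union> \<omega> ` A"
  have M: "finite M" using T A by (simp add: M_def)
  have "finite (M \<union> (\<Union>\<alpha>\<in>A. (\<lambda>\<tau>. \<tau> - \<omega> \<alpha>) ` M))" using M A by simp
  then obtain \<eta> where "\<eta> \<in> \<Gamma>" "\<eta> \<notin> M \<union> (\<Union>\<alpha>\<in>A. (\<lambda>\<tau>. \<tau> - \<omega> \<alpha>) ` M)"
    using infinite_grading by (meson finite_subset subsetI)
  then have \<eta>: "\<eta> \<in> \<Gamma>" "\<eta> \<notin> M" "\<And>\<alpha>. \<alpha> \<in> A \<Longrightarrow> \<eta> + \<omega> \<alpha> \<notin> M"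
    by (auto simp: image_iff eq_diff_eq)
  define z where "z = hv_basis (L 0 1) + hv_basis (L \<eta> 0)
    + (\<Sum>\<alpha>\<in>A. hv_basis (L (\<omega> \<alpha>) 0) + hv_basis (H \<alpha> 0))"
  have tL0: "hv_basis (L 0 1) \<in> V" by (intro hv_space_closed) (simp add: subgroup_closed(1))
  have z_in: "z \<in> V" unfolding z_def
    by (intro hv_space_closed) (use \<eta> A \<omega>_in in \<open>auto simp: subgroup_closed(1)\<close>)
  have lcz: "lc z \<gamma> = (if \<gamma> = 0 then mon 1 1 else 0) + (if \<gamma> = \<eta> then 1 else 0)
      + (\<Sum>\<alpha>\<in>A. if \<gamma> = \<omega> \<alpha> then 1 else 0)" for \<gamma>
    by (simp add: z_def coeff_sum cong: if_cong)
  have lcz0: "lc z \<gamma> = 0" if "\<gamma> \<noteq> 0" "\<gamma> \<noteq> \<eta>" "\<gamma> \<notin> \<omega> ` A" for \<gamma>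
    using that by (auto simp: lcz intro!: sum.neutral)
  have "lc z \<eta> = 1"
    using \<eta>(2) T(3) by (auto simp: lcz M_def intro!: sum.neutral)
  have lcz\<omega>: "lc z (\<omega> \<alpha>) = 1" if "\<alpha> \<in> A" for \<alpha>
    using that \<eta>(2) \<omega>T0[OF that] T(3) A(1) by (auto simp: lcz \<omega>_inj M_def)
  have hcz: "hc z \<gamma> = (if \<gamma> \<in> A then 1 else 0)" for \<gamma>
    using A(1) by (simp add: z_def coeff_sum)

  obtain D0 where D0: "derivation D0" "\<Delta> (hv_basis (L 0 1)) = D0 (hv_basis (L 0 1))" "\<Delta> z = D0 z"
    using two_localD(2)[OF tl tL0 z_in] by metis
  define \<Delta>' where "\<Delta>' = (\<lambda>x. \<Delta> x - D0 x)"
  have tl': "two_local \<Delta>'" unfolding \<Delta>'_def by (rule two_local_diff[OF tl D0(1)])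
  have \<Delta>'0: "\<Delta>' (hv_basis (L 0 1)) = 0" "\<Delta>' z = 0" using D0 by (simp_all add: \<Delta>'_def)

  \<comment> \<open>Pairing x with t L(0): an A-linear derivation preserving degrees cannot enlarge the support.\<close>
  have \<Delta>'_lc: "lc x \<gamma> = 0 \<Longrightarrow> lc (\<Delta>' x) \<gamma> = 0"
    and \<Delta>'_hc: "lc x \<gamma> = 0 \<Longrightarrow> hc x \<gamma> = 0 \<Longrightarrow> hc (\<Delta>' x) \<gamma> = 0"
    and \<Delta>'_lc0: "lc (\<Delta>' x) 0 = 0"
    and \<Delta>'_hc0: "hc x 0 = 0 \<Longrightarrow> hc (\<Delta>' x) 0 = 0" if x: "x \<in> V" for x \<gamma>
  proof -
    obtain D where D: "derivation D" "\<Delta>' x = D x" "D (hv_basis (L 0 1)) = 0"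
      using two_localD(2)[OF tl' x tL0] \<Delta>'0 by metis
    obtain c d h where form: "\<And>x \<gamma>. x \<in> V \<Longrightarrow> lc (D x) \<gamma> = c \<gamma> * lc x \<gamma>"
      "\<And>x \<gamma>. x \<in> V \<Longrightarrow> hc (D x) \<gamma> = d \<gamma> * lc x \<gamma> + (c \<gamma> + h) * hc x \<gamma>" "c 0 = 0" "d 0 = 0"
      using centralizer_of_tL0[OF D(1,3)] by metis
    show "lc x \<gamma> = 0 \<Longrightarrow> lc (\<Delta>' x) \<gamma> = 0" "lc x \<gamma> = 0 \<Longrightarrow> hc x \<gamma> = 0 \<Longrightarrow> hc (\<Delta>' x) \<gamma> = 0"
      "lc (\<Delta>' x) 0 = 0" "hc x 0 = 0 \<Longrightarrow> hc (\<Delta>' x) 0 = 0"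
      using x by (simp_all add: D(2) form)
  qed

  have ne: "\<alpha> \<noteq> 0" "\<omega> \<alpha> \<noteq> 0" "\<omega> \<alpha> \<noteq> \<alpha>" if "\<alpha> \<in> A" for \<alpha>
    using that \<omega>T0[OF that] A(3,4) T(3) by auto
  have probe_V: "probe (\<omega> \<alpha>) \<alpha> \<in> V" if "\<alpha> \<in> A" for \<alpha>
    using that A(2) \<omega>_in by (intro probe_in_space) auto
  have probe_lc: "lc (\<Delta>' (probe (\<omega> \<alpha>) \<alpha>)) \<gamma> = 0" if "\<alpha> \<in> A" "\<gamma> \<noteq> \<omega> \<alpha>" for \<alpha> \<gamma>
    using \<Delta>'_lc[OF probe_V[OF that(1)], of \<gamma>] \<Delta>'_lc0[OF probe_V[OF that(1)]] that
    by (cases "\<gamma> = 0") (simp_all add: lc_probe)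
  have probe_hc: "hc (\<Delta>' (probe (\<omega> \<alpha>) \<alpha>)) \<gamma> = 0" if "\<alpha> \<in> A" "\<gamma> \<noteq> \<omega> \<alpha>" "\<gamma> \<noteq> \<alpha>" for \<alpha> \<gamma>
    using \<Delta>'_hc[OF probe_V[OF that(1)], of \<gamma>] \<Delta>'_hc0[OF probe_V[OF that(1)]] that ne(1)[OF that(1)]
    by (cases "\<gamma> = 0") (simp_all add: lc_probe hc_probe)

  have \<Delta>'_probe: "\<Delta>' (probe (\<omega> \<alpha>) \<alpha>) = 0" if \<alpha>: "\<alpha> \<in> A" for \<alpha>
  proof -
    obtain D where D: "derivation D" "\<Delta>' (probe (\<omega> \<alpha>) \<alpha>) = D (probe (\<omega> \<alpha>) \<alpha>)" "D z = 0"
      using two_localD(2)[OF tl' probe_V[OF \<alpha>] z_in] \<Delta>'0 by metis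
    have \<alpha>\<Gamma>: "\<alpha> \<in> \<Gamma>" and \<omega>\<alpha>: "\<omega> \<alpha> = of_nat n * \<alpha>" using \<alpha> A(2) by (auto simp: \<omega>_def)
    have lc0: "lc (D (probe (\<omega> \<alpha>) \<alpha>)) \<gamma> = 0" if "\<gamma> \<noteq> \<omega> \<alpha>" for \<gamma>
      using probe_lc[OF \<alpha> that] D(2) by simp
    have hc0: "hc (D (probe (\<omega> \<alpha>) \<alpha>)) \<gamma> = 0" if "\<gamma> \<noteq> \<omega> \<alpha>" "\<gamma> \<noteq> \<alpha>" for \<gamma>
      using probe_hc[OF \<alpha> that] D(2) by simp
    obtain p c d h where
      lcD: "\<And>x \<gamma>. x \<in> V \<Longrightarrow> lc (D x) \<gamma> = mon 0 (2 * \<omega> \<alpha> - \<gamma>) * lc x (\<gamma> - \<omega> \<alpha>) * p + c \<gamma> * lc x \<gamma>" and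
      hcD: "\<And>x \<gamma>. x \<in> V \<Longrightarrow> hc (D x) \<gamma> = mon 0 (\<omega> \<alpha> - \<gamma>) * hc x (\<gamma> - \<omega> \<alpha>) * p
        + mon 0 \<alpha> * lc x (\<gamma> - \<alpha>) * p + d \<gamma> * lc x \<gamma> + (c \<gamma> + h) * hc x \<gamma>" and
      mult: "\<And>n \<alpha>. \<alpha> \<in> \<Gamma> \<Longrightarrow> c (of_nat n * \<alpha>) = of_nat n * c \<alpha>"
        "\<And>n \<alpha>. \<alpha> \<in> \<Gamma> \<Longrightarrow> d (of_nat n * \<alpha>) = of_nat n * d \<alpha>"
      by (rule normalizer_of_probe[OF D(1) \<alpha>\<Gamma> ne(1)[OF \<alpha>] n(1) \<omega>\<alpha>],
            rule lc0, assumption, rule hc0, assumption, assumption) (rule that)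
    have zero: "c 0 = 0" "d 0 = 0" using mult[OF subgroup_closed(1), of 0] by simp_all
    \<comment> \<open>The inner part of D would move L(eta) to the degree eta + omega, where z has nothing for the rest of D to act on.\<close>
    have "lc z (\<eta> + \<omega> \<alpha>) = 0"
      using \<eta>(3)[OF \<alpha>] ne[OF \<alpha>] T(3) by (intro lcz0) (auto simp: M_def)
    then have "mon 0 (\<omega> \<alpha> - \<eta>) * p = 0"
      using lcD[OF z_in, of "\<eta> + \<omega> \<alpha>"] D(3) \<open>lc z \<eta> = 1\<close> by simp
    then have p: "p = 0" using \<eta>(2) \<alpha> by (auto simp: M_def)
    have c\<omega>: "c (\<omega> \<alpha>) = 0" using lcD[OF z_in, of "\<omega> \<alpha>"] D(3) p lcz\<omega>[OF \<alpha>] by simp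
    have "\<omega> \<alpha> \<notin> A" using \<omega>T0[OF \<alpha>] A(3) by blast
    then have d\<omega>: "d (\<omega> \<alpha>) = 0"
      using hcD[OF z_in, of "\<omega> \<alpha>"] D(3) p lcz\<omega>[OF \<alpha>] by (simp add: hcz)
    have "lc z \<alpha> = 0"
      using \<alpha> ne[OF \<alpha>] \<eta>(2) \<omega>T0 A(3) by (intro lcz0) (auto simp: M_def)
    then have h: "c \<alpha> + h = 0" using hcD[OF z_in, of \<alpha>] D(3) p \<alpha> by (simp add: hcz)
    have "D (probe (\<omega> \<alpha>) \<alpha>) = 0"
    proof (rule hv_eqI)
      fix \<gamma>
      show "lc (D (probe (\<omega> \<alpha>) \<alpha>)) \<gamma> = lc 0 \<gamma>" "hc (D (probe (\<omega> \<alpha>) \<alpha>)) \<gamma> = hc 0 \<gamma>"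
        using zero c\<omega> d\<omega> h ne[OF \<alpha>] by (simp_all add: lcD hcD probe_V[OF \<alpha>] p lc_probe hc_probe)
    qed
    then show ?thesis using D(2) by simp
  qed

  have "\<Delta>' x = 0"
    if x: "x \<in> V" "\<And>\<gamma>. \<gamma> \<notin> T \<Longrightarrow> lc x \<gamma> = 0" "\<And>\<gamma>. \<gamma> \<notin> T \<Longrightarrow> hc x \<gamma> = 0" for x
  proof -
    have at: "lc (\<Delta>' x) \<alpha> = 0" "hc (\<Delta>' x) \<alpha> = 0" "hc (\<Delta>' x) 0 = 0" if \<alpha>: "\<alpha> \<in> A" for \<alpha>
    proof -
      obtain D where D: "derivation D" "\<Delta>' x = D x" "D (probe (\<omega> \<alpha>) \<alpha>) = 0"
        using two_localD(2)[OF tl' x(1) probe_V[OF \<alpha>]] \<Delta>'_probe[OF \<alpha>] by metis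
      have \<alpha>\<Gamma>: "\<alpha> \<in> \<Gamma>" and \<omega>\<alpha>: "\<omega> \<alpha> = of_nat n * \<alpha>" using \<alpha> A(2) by (auto simp: \<omega>_def)
      have "lc (D x) \<gamma> = 0" "hc (D x) \<gamma> = 0" if "\<gamma> \<notin> T" for \<gamma>
        using that x \<Delta>'_lc[OF x(1), of \<gamma>] \<Delta>'_hc[OF x(1), of \<gamma>] D(2) by simp_all
      note vanish = centralizer_of_probe[OF D(1) \<alpha>\<Gamma> ne(1)[OF \<alpha>] n(1) \<omega>\<alpha> D(3) T(3) \<omega>T[OF \<alpha>] x this]
      show "lc (\<Delta>' x) \<alpha> = 0" "hc (\<Delta>' x) \<alpha> = 0" "hc (\<Delta>' x) 0 = 0"
        unfolding D(2) by (rule vanish; assumption)+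
    qed
    show ?thesis
    proof (rule hv_eqI)
      fix \<gamma>
      show "lc (\<Delta>' x) \<gamma> = lc 0 \<gamma>" "hc (\<Delta>' x) \<gamma> = hc 0 \<gamma>"
        using at[of \<gamma>] at(3)[OF A(5)] \<Delta>'_lc0[OF x(1)] \<Delta>'_lc[OF x(1), of \<gamma>] \<Delta>'_hc[OF x(1), of \<gamma>]
          x(2)[of \<gamma>] x(3)[of \<gamma>] by (auto simp: A_def)
    qed
  qed
  then show ?thesis
    using T(4) by (intro that[OF D0(1)]) (auto simp: \<Delta>'_def)
qed

text \<open>
  Additivity, homogeneity and the Leibniz rule for given arguments concern at most three
  elements, whose degrees form a finite set.
\<close>

theorem two_local_is_derivation:
  assumes tl: "two_local \<Delta>" shows "derivation \<Delta>"
proof -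
  have agree: "\<exists>D. derivation D \<and> (\<forall>x\<in>X. \<Delta> x = D x)" if X: "finite X" "X \<subseteq> V" for X
  proof -
    define S where "S = (\<Union>x\<in>X. {\<gamma>. lc x \<gamma> \<noteq> 0} \<union> {\<gamma>. hc x \<gamma> \<noteq> 0})"
    have "finite S" unfolding S_def using X(1) by (simp add: finite_coeff_support)
    moreover have "S \<subseteq> \<Gamma>" unfolding S_def using X(2) hv_space_coeff_outside by blast
    ultimately obtain D where D: "derivation D" "\<And>x. x \<in> V \<Longrightarrow> (\<And>\<gamma>. \<gamma> \<notin> S \<Longrightarrow> lc x \<gamma> = 0) \<Longrightarrow>
        (\<And>\<gamma>. \<gamma> \<notin> S \<Longrightarrow> hc x \<gamma> = 0) \<Longrightarrow> \<Delta> x = D x"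
      using two_local_is_derivation_on_finite_support[OF tl] by metis
    have "\<Delta> x = D x" if "x \<in> X" for x
      using that X(2) by (intro D(2)) (auto simp: S_def)
    with D(1) show ?thesis by blast
  qed
  show ?thesis unfolding derivation_on_def
  proof (intro conjI ballI allI Pi_I)
    fix x assume "x \<in> V" then show "\<Delta> x \<in> V" by (rule two_localD(1)[OF tl])
  next
    fix x y assume "x \<in> V" "y \<in> V"
    then show "\<Delta> (x + y) = \<Delta> x + \<Delta> y" "\<Delta> (hv_bracket x y) = hv_bracket (\<Delta> x) y + hv_bracket x (\<Delta> y)"
      using agree[of "{x, y, x + y}"] agree[of "{x, y, hv_bracket x y}"]
      by (auto simp: hv_space_closed(2,5) derivationD)
  next
    fix c x assume "x \<in> V"
    then show "\<Delta> (hv_scale c x) = hv_scale c (\<Delta> x)"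
      using agree[of "{x, hv_scale c x}"] by (auto simp: hv_space_closed(4) derivationD)
  qed
qed

end

theorem theorem10:
  fixes \<Gamma> :: "'a::{alg_closed_field, field_char_0} set"
    and \<Delta> :: "'a hv \<Rightarrow> 'a hv"
  assumes "additive_subgroup \<Gamma>"
    and "\<Gamma> \<noteq> {0}"
    and "two_local_derivation_on hv_scale (hv_space \<Gamma>) hv_bracket \<Delta>"
  shows "derivation_on hv_scale (hv_space \<Gamma>) hv_bracket \<Delta>"
proof -
  interpret hv_grading \<Gamma> by unfold_locales (use assms in auto)
  show ?thesis using assms(3) by (rule two_local_is_derivation)
qed

end
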